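(* Let $I\subseteq\mathbb{R}$ be a nonempty open interval and let $\varphi,f,F:I\to\mathbb{R}$ be functions such that $\varphi$ is continuous. Then $$\varphi\Big(\frac{x+y}{2}\Big)\big(f(x)-f(y)\big)=F(x)-F(y)\qquad\text{for all }x,y\in I$$ if and only if at least one of the following alternatives holds: (i) $f$ and $F$ are constant functions on $I$ (and $\varphi$ is arbitrary); (ii) there exist $A\in\varphi(I)$, a nonempty closed interval $K\subseteq I$ and constants $\lambda_*,\lambda^*,\mu\in\mathbb{R}$ such that $f(x)=\lambda_*$ for all $x\in K_*$, $f(x)=\lambda^*$ for all $x\in K^*$, $\varphi(x)=A$ for all $x\in\frac12(I+K)$, and $F=Af+\mu$ on $I$; (iii) there exist constants $A,B,C,D\in\mathbb{R}$ with $AD\neq BC$ and $\gamma,\mu,\lambda\in\mathbb{R}$ such that, for all $x\in I$: - if $\gamma<0$: $$F(x)=-C\cos(\sqrt{-\gamma}\,x)+D\sin(\sqrt{-\gamma}\,x)+\mu,\quad f(x)=-A\cos(\sqrt{-\gamma}\,x)+B\sin(\sqrt{-\gamma}\,x)+\lambda,\quad \varphi(x)=\frac{C\sin(\sqrt{-\gamma}\,x)+D\cos(\sqrt{-\gamma}\,x)}{A\sin(\sqrt{-\gamma}\,x)+B\cos(\sqrt{-\gamma}\,x)};$$ - if $\gamma=0$: $$F(x)=\tfrac12Cx^2+Dx+\mu,\quad f(x)=\tfrac12Ax^2+Bx+\lambda,\quad \varphi(x)=\frac{Cx+D}{Ax+B};$$ - if $\gamma>0$: $$F(x)=C\cosh(\sqrt{\gamma}\,x)+D\sinh(\sqrt{\gamma}\,x)+\mu,\quad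 f(x)=A\cosh(\sqrt{\gamma}\,x)+B\sinh(\sqrt{\gamma}\,x)+\lambda,\quad \varphi(x)=\frac{C\sinh(\sqrt{\gamma}\,x)+D\cosh(\sqrt{\gamma}\,x)}{A\sinh(\sqrt{\gamma}\,x)+B\cosh(\sqrt{\gamma}\,x)}.$$
   Context: For a set $S\subseteq I$: $S_*:=\{x\in I\mid x<\inf S\}$ and $S^*:=\{x\in I\mid \sup S<x\}$. Also $\frac12(I+K):=\{\frac{x+k}{2}\mid x\in I,\ k\in K\}$. "Closed interval $K\subseteq I$" means an interval contained in $I$ that is closed relative to $I$ (so $K=I$ is allowed, and singletons are allowed). In (iii), the formula for $\varphi$ includes the requirement that its denominator is nowhere zero on $I$. *)

theory Defs
  imports "HOL-Analysis.Analysis"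
begin

text \<open>The infimum and supremum are taken in the extended reals: on type \<open>real\<close> they are
  unspecified for unbounded (or empty) sets, whereas \<open>S\<close> may be unbounded here
  (for instance \<open>S = I = UNIV\<close>).\<close>

definition lower_part :: "real set \<Rightarrow> real set \<Rightarrow> real set" where
  "lower_part I S = {x \<in> I. ereal x < Inf (ereal ` S)}"

definition upper_part :: "real set \<Rightarrow> real set \<Rightarrow> real set" where
  "upper_part I S = {x \<in> I. Sup (ereal ` S) < ereal x}"

definition half_sum :: "real set \<Rightarrow> real set \<Rightarrow> real set" where
  "half_sum I K = {(x + k) / 2 | x k. x \<in> I \<and> k \<in> K}"

end

theory Submission
  imports Defs
begin

text \<open>
  If \<open>\<phi>\<close> is constant on \<open>(x0 + I) / 2\<close> for some \<open>x0 \<in> I\<close>, then \<open>F = A f + \<mu>\<close>, and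
  \<open>(\<phi> ((x + y) / 2) - A) (f x - f y) = 0\<close> leads to alternative (i) or (ii), with \<open>K\<close> the set of
  all such \<open>x0\<close>. Otherwise the identity obtained by eliminating \<open>F\<close> from three instances of
  the equation expresses \<open>f\<close> locally through \<open>\<phi>\<close>, so \<open>f\<close> is continuous.

  If \<open>f\<close> is continuous but not injective, bisecting chords gives a point \<open>p\<close> with arbitrarily
  close points of equal value; then \<open>q \<mapsto> \<phi> ((p + q) / 2)\<close> is locally constant where
  \<open>f q \<noteq> f p\<close>, and a connectedness argument shows that it is constant there, so that again
  \<open>F = A f + \<mu>\<close>.

  If \<open>f\<close> is injective, integrating the equation shows that \<open>\<phi>\<close> is one degree smoother than
  \<open>f\<close> and \<open>F\<close>, and these are as smooth as \<open>\<phi>\<close>; so all three are smooth. Differentiating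
  gives \<open>F' = \<phi> f'\<close>, \<open>F''' = \<phi> f'''\<close>, hence \<open>\<phi>' f'^2\<close> is a nonzero constant and \<open>\<phi>\<close> is
  injective. At \<open>x, y\<close> with midpoint \<open>m\<close> the vectors \<open>(f' x, f' y)\<close> and \<open>(f''' x, f''' y)\<close>
  are both orthogonal to \<open>(\<phi> x - \<phi> m, \<phi> y - \<phi> m)\<close>, so \<open>f''' / f'\<close> is a constant \<open>\<gamma>\<close>.
  Solving \<open>g'' = \<gamma> g\<close> for \<open>g = f'\<close> and \<open>g = F'\<close> gives (iii).
\<close>

section \<open>Affinely dependent \<open>f\<close> and \<open>F\<close>\<close>

locale midpoint_equation =
  fixes I :: "real set" and \<phi> f F :: "real \<Rightarrow> real"
  assumes interval: "is_interval I" and open_I: "open I"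
    and cont: "continuous_on I \<phi>"
    and eq: "\<And>x y. x \<in> I \<Longrightarrow> y \<in> I \<Longrightarrow> \<phi> ((x + y) / 2) * (f x - f y) = F x - F y"
begin

lemma between: "a \<in> I \<Longrightarrow> b \<in> I \<Longrightarrow> a \<le> x \<Longrightarrow> x \<le> b \<Longrightarrow> x \<in> I"
  using interval by (meson mem_is_interval_1_I)

lemma midpoint_mem: "x \<in> I \<Longrightarrow> y \<in> I \<Longrightarrow> (x + y) / 2 \<in> I"
  by (rule between[of "min x y" "max x y"]) (auto simp: min_def max_def)

lemma isCont_\<phi>_midpoint:
  assumes "x \<in> I" "y \<in> I"
  shows "isCont (\<lambda>t. \<phi> ((t + y) / 2)) x"
proof -
  have "isCont \<phi> ((x + y) / 2)"
    using cont open_I midpoint_mem[OF assms] by (simp add: continuous_on_eq_continuous_at)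
  moreover have "isCont (\<lambda>t. (t + y) / 2) x" by (intro continuous_intros) auto
  ultimately show ?thesis by (rule isCont_o2[rotated])
qed

lemma eventually_in_I: "x \<in> I \<Longrightarrow> \<forall>\<^sub>F t in at x. t \<in> I"
  using open_I by (simp add: eventually_at_in_open')

text \<open>Where the left-hand factor is not \<open>A\<close>, the relation \<open>F = A f + \<mu>\<close> forces
  \<open>f x = f y\<close>; so \<open>f\<close> is locally constant off \<open>K\<close>.\<close>

lemma affine_imp_plateau:
  assumes F: "\<And>x. x \<in> I \<Longrightarrow> F x = A * f x + \<mu>" and nc: "\<not> f constant_on I"
  shows "\<exists>A\<in>\<phi> ` I. \<exists>K lam_lo lam_up \<mu>.
          K \<noteq> {} \<and> K \<subseteq> I \<and> is_interval K \<and> closedin (top_of_set I) K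
          \<and> (\<forall>x\<in>lower_part I K. f x = lam_lo)
          \<and> (\<forall>x\<in>upper_part I K. f x = lam_up)
          \<and> (\<forall>x\<in>half_sum I K. \<phi> x = A)
          \<and> (\<forall>x\<in>I. F x = A * f x + \<mu>)"
proof -
  \<comment> \<open>This is the largest set compatible with \<open>\<phi> = A\<close> on
    \<open>half_sum I K\<close>, so that requirement holds by construction. What remains is that it
    is a nonempty, relatively closed interval.\<close>
  define K where "K = {x \<in> I. \<forall>y\<in>I. \<phi> ((x + y) / 2) = A}"
  have loc: "(f has_real_derivative 0) (at x)" if x: "x \<in> I" "x \<notin> K" for x
  proof -
    obtain y where y: "y \<in> I" "\<phi> ((x + y) / 2) \<noteq> A" using x by (auto simp: K_def)
    have "\<forall>\<^sub>F t in at x. \<phi> ((t + y) / 2) \<noteq> A"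
      using isCont_\<phi>_midpoint[OF x(1) y(1)] y(2)
      by (auto simp: isCont_def intro: tendsto_imp_eventually_ne)
    then have "\<forall>\<^sub>F t in nhds x. t \<in> I \<and> \<phi> ((t + y) / 2) \<noteq> A"
      using eventually_in_I[OF x(1)] x(1) y(2)
      by (auto simp: eventually_nhds_conv_at eventually_conj_iff)
    moreover have "f t = f y" if "t \<in> I" "\<phi> ((t + y) / 2) \<noteq> A" for t
    proof -
      have "(\<phi> ((t + y) / 2) - A) * (f t - f y) = 0"
        using eq[OF that(1) y(1)] F[OF that(1)] F[OF y(1)] by (simp add: algebra_simps)
      then show ?thesis using that by simp
    qed
    ultimately have "\<forall>\<^sub>F t in nhds x. f t = f y" by (auto elim: eventually_mono)
    from DERIV_cong_ev[OF refl this refl, of 0] show ?thesis by simp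
  qed
  \<comment> \<open>The vanishing derivative gives constancy on every segment of \<open>I\<close>
    that misses \<open>K\<close>. In particular \<open>K\<close> cannot be empty when
    \<open>f\<close> is nonconstant.\<close>
  have const: "f a = f b" if "a \<in> I" "b \<in> I" "\<And>t. t \<in> I \<Longrightarrow> min a b \<le> t \<Longrightarrow> t \<le> max a b \<Longrightarrow> t \<notin> K" for a b
  proof -
    have *: "f a = f b" if ab: "a < b" "a \<in> I" "b \<in> I" "\<And>t. t \<in> I \<Longrightarrow> a \<le> t \<Longrightarrow> t \<le> b \<Longrightarrow> t \<notin> K" for a b
    proof -
      have d: "(f has_real_derivative 0) (at x)" if "a \<le> x" "x \<le> b" for x
        using loc[of x] ab between that by blast
      have "continuous_on {a..b} f"
        by (meson DERIV_isCont atLeastAtMost_iff continuous_at_imp_continuous_on d)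
      from DERIV_isconst_end[OF ab(1) this d] show ?thesis by simp
    qed
    consider "a < b" | "a = b" | "b < a" by linarith
    then show ?thesis
    proof cases
      case 1
      show ?thesis by (rule *[OF 1]) (use 1 that in auto)
    next
      case 3
      show ?thesis by (rule *[OF 3, symmetric]) (use 3 that in auto)
    qed simp
  qed
  have Kne: "K \<noteq> {}"
  proof
    assume "K = {}"
    then have "f constant_on I"
      unfolding constant_on_def using const by (metis empty_iff)
    with nc show False ..
  qed
  have KI: "K \<subseteq> I" by (auto simp: K_def)
  have Kint: "is_interval K"
  proof (unfold is_interval_1, intro ballI allI impI)
    fix x0 x1 x assume x0: "x0 \<in> K" and x1: "x1 \<in> K" and "x0 \<le> x \<and> x \<le> x1"
    then have x: "x0 \<le> x" "x \<le> x1" by auto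
    have "\<phi> ((x + y) / 2) = A" if y: "y \<in> I" for y
    \<comment> \<open>The sum \<open>x + y\<close> is split again, as \<open>x0\<close> or
      \<open>x1\<close> plus a new partner. Comparing it with \<open>x0 + x1\<close> decides for
      which of the two the partner lies between points of \<open>I\<close>.\<close>
    proof (cases "x + y \<le> x0 + x1")
      case True
      have "x + y - x0 \<in> I" by (rule between[of y x1]) (use True x y x1 KI in auto)
      with x0 have "\<phi> ((x0 + (x + y - x0)) / 2) = A" unfolding K_def by blast
      then show ?thesis by simp
    next
      case False
      have "x + y - x1 \<in> I" by (rule between[of x0 y]) (use False x y x0 KI in auto)
      with x1 have "\<phi> ((x1 + (x + y - x1)) / 2) = A" unfolding K_def by blast
      then show ?thesis by simp
    qed
    moreover have "x \<in> I" using between x0 x1 x KI by blast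
    ultimately show "x \<in> K" by (simp add: K_def)
  qed
  have Kcl: "closedin (top_of_set I) K"
  proof -
    have "closedin (top_of_set I) {x \<in> I. \<phi> ((x + y) / 2) = A}" if "y \<in> I" for y
      using isCont_\<phi>_midpoint[OF _ that]
      by (intro continuous_closedin_preimage_constant continuous_at_imp_continuous_on) auto
    \<comment> \<open>Relative closedness passes to intersections over a nonempty index set, and
      \<open>I\<close> is nonempty because \<open>K\<close> is.\<close>
    moreover have "K = (\<Inter>y\<in>I. {x \<in> I. \<phi> ((x + y) / 2) = A})"
      using Kne by (auto simp: K_def)
    moreover have "I \<noteq> {}" using Kne KI by auto
    ultimately show ?thesis by (metis (no_types, lifting) closedin_INT)
  qed
  obtain c where lo: "\<forall>x\<in>lower_part I K. f x = c"
  proof -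
    have "f a = f b" if "a \<in> lower_part I K" "b \<in> lower_part I K" for a b
    proof (rule const)
      show "a \<in> I" "b \<in> I" using that by (auto simp: lower_part_def)
      fix t assume "t \<le> max a b"
      then have "ereal t \<le> ereal (max a b)" by (simp only: ereal_less_eq)
      also have "\<dots> < Inf (ereal ` K)" using that by (simp add: lower_part_def max_def)
      finally show "t \<notin> K" by (meson INF_lower leD)
    qed
    then show thesis by (metis that)
  qed
  obtain d where up: "\<forall>x\<in>upper_part I K. f x = d"
  proof -
    have "f a = f b" if "a \<in> upper_part I K" "b \<in> upper_part I K" for a b
    proof (rule const)
      show "a \<in> I" "b \<in> I" using that by (auto simp: upper_part_def)
      fix t assume "min a b \<le> t"
      then have "ereal (min a b) \<le> ereal t" by (simp only: ereal_less_eq)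
      moreover have "Sup (ereal ` K) < ereal (min a b)"
        using that by (simp add: upper_part_def min_def)
      ultimately have "Sup (ereal ` K) < ereal t" by order
      then show "t \<notin> K" by (meson SUP_upper leD)
    qed
    then show thesis by (metis that)
  qed
  obtain k where k: "k \<in> K" using Kne by auto
  then have "\<phi> ((k + k) / 2) = A" "k \<in> I" by (auto simp: K_def)
  then have "A \<in> \<phi> ` I" by force
  moreover have "\<forall>x\<in>half_sum I K. \<phi> x = A"
  proof
    fix x assume "x \<in> half_sum I K"
    then obtain y k where "x = (y + k) / 2" "y \<in> I" "k \<in> K"
      unfolding half_sum_def by blast
    then show "\<phi> x = A" unfolding K_def by (auto simp only: mem_Collect_eq add.commute[of y k])
  qed
  ultimately show ?thesis
    using Kne KI Kint Kcl lo up F by (intro bexI[of _ A] exI[of _ K] exI[of _ c] exI[of _ d] exI[of _ \<mu>] conjI) auto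
qed

lemma constant_midpoints_imp_affine:
  assumes "x0 \<in> I" "\<And>y. y \<in> I \<Longrightarrow> \<phi> ((x0 + y) / 2) = A"
  shows "\<exists>\<mu>. \<forall>x\<in>I. F x = A * f x + \<mu>"
proof (intro exI ballI)
  fix x assume x: "x \<in> I"
  have "A * (f x0 - f x) = F x0 - F x" using eq[OF assms(1) x] assms(2)[OF x] by simp
  then show "F x = A * f x + (F x0 - A * f x0)" by (simp add: algebra_simps)
qed

text \<open>The differences of \<open>F\<close> along the three sides cancel, so adding the
  equations eliminates \<open>F\<close>. With \<open>y\<close> and \<open>z\<close> fixed,
  \<open>f\<close> becomes locally a quotient of expressions in \<open>\<phi>\<close>, which
  transfers regularity from \<open>\<phi>\<close> to \<open>f\<close>.\<close>

lemma three_point: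
  assumes "x \<in> I" "y \<in> I" "z \<in> I"
  shows "f x * (\<phi> ((x + y) / 2) - \<phi> ((x + z) / 2))
    = (\<phi> ((x + y) / 2) - \<phi> ((y + z) / 2)) * f y + (\<phi> ((y + z) / 2) - \<phi> ((x + z) / 2)) * f z"
  using eq[OF assms(1,2)] eq[OF assms(2,3)] eq[OF assms(1,3)] by (simp add: algebra_simps)

end

section \<open>Non-injective \<open>f\<close>\<close>

lemma last_hit:
  fixes g :: "real \<Rightarrow> real"
  assumes "a \<le> b" "continuous_on {a..b} g" "g a \<le> v" "v \<le> g b"
  obtains t where "a \<le> t" "t \<le> b" "g t = v" "\<And>u. t < u \<Longrightarrow> u \<le> b \<Longrightarrow> v < g u"
proof -
  define T where "T = {t \<in> {a..b}. g t = v}"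
  \<comment> \<open>The intermediate value theorem on \<open>{c..b}\<close> puts a point of the
    level set \<open>T\<close> at or to the right of any \<open>c\<close> with
    \<open>g c \<le> v\<close>. Hence no such \<open>c\<close> lies beyond the maximum of the
    compact set \<open>T\<close>.\<close>
  have ivt: "\<exists>t\<in>T. c \<le> t" if "g c \<le> v" "a \<le> c" "c \<le> b" for c
    using IVT'[of g c v b] that assms continuous_on_subset[OF assms(2), of "{c..b}"]
    unfolding T_def by fastforce
  have ne: "T \<noteq> {}" using ivt[of a] assms by auto
  have "compact T"
  proof -
    have "closedin (top_of_set {a..b}) T"
      unfolding T_def by (rule continuous_closedin_preimage_constant[OF assms(2)])
    then show ?thesis by (rule closedin_compact[rotated]) simp
  qed
  from compact_attains_sup[OF this ne]
  obtain t where t: "t \<in> T" "\<And>u. u \<in> T \<Longrightarrow> u \<le> t" by auto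
  show thesis
  proof (rule that[of t])
    show "a \<le> t" "t \<le> b" "g t = v" using t by (auto simp: T_def)
    fix u assume u: "t < u" "u \<le> b"
    show "v < g u"
    proof (rule ccontr)
      assume "\<not> v < g u"
      then obtain w where "w \<in> T" "u \<le> w" using ivt[of u] u \<open>a \<le> t\<close> by auto
      with t(2)[of w] u show False by simp
    qed
  qed
qed

text \<open>Obtained from \<open>last_hit\<close> by the reflection
  \<open>x \<mapsto> - x\<close>.\<close>

lemma first_hit:
  fixes g :: "real \<Rightarrow> real"
  assumes "a \<le> b" "continuous_on {a..b} g" "g b \<le> v" "v \<le> g a"
  obtains t where "a \<le> t" "t \<le> b" "g t = v" "\<And>u. a \<le> u \<Longrightarrow> u < t \<Longrightarrow> v < g u"
proof -
  have "continuous_on {-b..-a} (\<lambda>x. g (- x))"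
    by (rule continuous_on_compose2[OF assms(2)]) (auto intro: continuous_intros)
  then obtain t where t: "-b \<le> t" "t \<le> -a" "g (-t) = v" "\<And>u. t < u \<Longrightarrow> u \<le> -a \<Longrightarrow> v < g (-u)"
    using last_hit[of "-b" "-a" "\<lambda>x. g (- x)" v] assms by auto
  show thesis
    by (rule that[of "-t"]) (use t t(4)[of "- _"] in \<open>auto\<close>)
qed

text \<open>Steps of length \<open>\<delta>\<close> starting at \<open>a\<close> keep the value
  \<open>g a\<close> and end within \<open>\<delta>\<close> of \<open>b\<close>. As
  \<open>\<delta>\<close> can be taken arbitrarily small, continuity at \<open>b\<close> transfers
  the value.\<close>

lemma small_periods_imp_constant:
  fixes g :: "real \<Rightarrow> real"
  assumes J: "is_interval J" and c: "continuous_on J g"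
    and per: "\<And>e. e > 0 \<Longrightarrow> \<exists>\<delta>. 0 < \<delta> \<and> \<delta> < e \<and> (\<forall>m. m \<in> J \<longrightarrow> m + \<delta> \<in> J \<longrightarrow> g (m + \<delta>) = g m)"
    and ab: "a \<in> J" "b \<in> J" "a \<le> b"
  shows "g a = g b"
proof (rule ccontr)
  assume "g a \<noteq> g b"
  then have "dist (g a) (g b) > 0" by simp
  with c ab(2) obtain d where d: "d > 0" "\<And>x. x \<in> J \<Longrightarrow> dist x b < d \<Longrightarrow> dist (g x) (g b) < dist (g a) (g b)"
    unfolding continuous_on_iff by meson
  obtain \<delta> where \<delta>: "0 < \<delta>" "\<delta> < d" "\<And>m. m \<in> J \<Longrightarrow> m + \<delta> \<in> J \<Longrightarrow> g (m + \<delta>) = g m"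
    using per[OF d(1)] by blast
  \<comment> \<open>The number of whole steps that fit: \<open>a + N * \<delta>\<close> is at most
    \<open>b\<close> but exceeds \<open>b - \<delta>\<close>.\<close>
  define N where "N = nat \<lfloor>(b - a) / \<delta>\<rfloor>"
  have N: "real N \<le> (b - a) / \<delta>" "(b - a) / \<delta> < real N + 1"
    using ab \<delta> by (auto simp: N_def intro: divide_nonneg_pos)
  then have N': "a + real N * \<delta> \<le> b" "b < a + real N * \<delta> + \<delta>"
    using \<delta>(1) by (auto simp: field_simps)
  have mem: "a + real n * \<delta> \<in> J" if "n \<le> N" for n
  proof -
    have "real n * \<delta> \<le> real N * \<delta>" "0 \<le> real n * \<delta>" using that \<delta> by auto
    with N' have "a \<le> a + real n * \<delta>" "a + real n * \<delta> \<le> b" by linarith+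
    then show ?thesis using J ab by (meson mem_is_interval_1_I)
  qed
  have "n \<le> N \<Longrightarrow> g (a + real n * \<delta>) = g a" for n
  proof (induction n)
    case (Suc n)
    then show ?case
      using \<delta>(3)[of "a + real n * \<delta>"] mem[of n] mem[of "Suc n"] by (simp add: algebra_simps)
  qed simp
  then have "g (a + real N * \<delta>) = g a" by simp
  moreover have "dist (a + real N * \<delta>) b < d" using N' \<delta> by (simp add: dist_real_def)
  ultimately show False using d(2)[OF mem[of N]] by simp
qed

text \<open>The function \<open>g (t + h) - g t\<close> takes opposite values at
  \<open>t = x\<close> and \<open>t = x + h\<close>, since the two add up to
  \<open>g (x + 2 * h) - g x = 0\<close>. So it has a zero in between.\<close>

lemma halve_chord:
  fixes g :: "real \<Rightarrow> real"
  assumes "continuous_on {x..x + 2 * h} g" "g x = g (x + 2 * h)" "h > 0"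
  obtains t where "x \<le> t" "t + h \<le> x + 2 * h" "g t = g (t + h)"
proof -
  have c: "continuous_on {x..x + h} (\<lambda>t. g (t + h) - g t)"
    by (intro continuous_intros continuous_on_compose2[OF assms(1)]) (use assms in auto)
  have "\<exists>t. x \<le> t \<and> t \<le> x + h \<and> g (t + h) - g t = 0"
  proof (cases "g (x + h) - g x \<le> 0")
    case True
    then show ?thesis using assms by (intro IVT'[OF _ _ _ c]) (auto simp: algebra_simps)
  next
    case False
    then show ?thesis using assms by (intro IVT2'[OF _ _ _ c]) (auto simp: algebra_simps)
  qed
  then show thesis using that by force
qed

text \<open>Repeated halving yields horizontal chords of length tending to zero. A limit point of
  their left ends is approached by both ends.\<close>

lemma small_chords:
  fixes g :: "real \<Rightarrow> real"
  assumes c: "continuous_on {a..b} g" and "a < b" "g a = g b"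
  obtains p where "a \<le> p" "p \<le> b"
    "\<And>e. e > 0 \<Longrightarrow> \<exists>x y. x < y \<and> a \<le> x \<and> y \<le> b \<and> \<bar>x - p\<bar> < e \<and> \<bar>y - p\<bar> < e \<and> g x = g y"
proof -
  define h where "h n = (b - a) / 2 ^ n" for n :: nat
  have h: "h n > 0" "h n = 2 * h (Suc n)" for n using assms by (auto simp: h_def field_simps)
  have "\<exists>x. a \<le> x \<and> x + h n \<le> b \<and> g x = g (x + h n)" for n
  proof (induction n)
    case 0 then show ?case using assms by (intro exI[of _ a]) (auto simp: h_def)
  next
    case (Suc n)
    then obtain x where x: "a \<le> x" "x + 2 * h (Suc n) \<le> b" "g x = g (x + 2 * h (Suc n))"
      using h(2)[of n] by auto
    obtain t where "x \<le> t" "t + h (Suc n) \<le> x + 2 * h (Suc n)" "g t = g (t + h (Suc n))"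
      using halve_chord[OF continuous_on_subset[OF c] x(3) h(1)] x by auto
    then show ?case using x by (intro exI[of _ t]) auto
  qed
  then obtain s where s: "\<And>n. a \<le> s n" "\<And>n. s n + h n \<le> b" "\<And>n. g (s n) = g (s n + h n)" by metis
  have "s n \<in> {a..b}" for n using s(1)[of n] s(2)[of n] h(1)[of n] by auto
  \<comment> \<open>The chosen chords need not be nested, so \<open>p\<close> comes from
    compactness, along a subsequence \<open>r\<close>.\<close>
  then obtain p r where p: "p \<in> {a..b}" and r: "strict_mono r" "(s \<circ> r) \<longlonglongrightarrow> p"
    using compact_Icc[of a b] unfolding compact_def by metis
  have "h \<longlonglongrightarrow> 0" unfolding h_def by (rule LIMSEQ_divide_realpow_zero) simp
  then have "(h \<circ> r) \<longlonglongrightarrow> 0" by (rule LIMSEQ_subseq_LIMSEQ[OF _ r(1)])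
  from tendsto_add[OF r(2) this] have lim: "(\<lambda>n. s (r n) + h (r n)) \<longlonglongrightarrow> p"
    by (simp add: o_def)
  show thesis
  proof (rule that[of p])
    fix e :: real assume "e > 0"
    then have "\<forall>\<^sub>F n in sequentially. dist (s (r n)) p < e \<and> dist (s (r n) + h (r n)) p < e"
      using tendstoD[OF lim, of e] tendstoD[OF r(2), of e] by (simp add: eventually_conj_iff o_def)
    from eventually_happens'[OF sequentially_bot this]
    obtain n where "dist (s (r n)) p < e" "dist (s (r n) + h (r n)) p < e" by auto
    then show "\<exists>x y. x < y \<and> a \<le> x \<and> y \<le> b \<and> \<bar>x - p\<bar> < e \<and> \<bar>y - p\<bar> < e \<and> g x = g y"
      using s(1,2)[of "r n"] s(3)[of "r n"] h(1)[of "r n"]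
      by (intro exI[of _ "s (r n)"] exI[of _ "s (r n) + h (r n)"]) (auto simp: dist_real_def)
  qed (use p in auto)
qed

section \<open>Continuity of \<open>f\<close>, and local constancy of \<open>\<phi>\<close> forced
  by repeated values of \<open>f\<close>\<close>

context midpoint_equation
begin

lemma f_eq_imp_F_eq: "x \<in> I \<Longrightarrow> y \<in> I \<Longrightarrow> f x = f y \<Longrightarrow> F x = F y"
  using eq[of x y] by simp

text \<open>The change of sign keeps \<open>\<phi>\<close> and exchanges the regions above and below
  a level of \<open>f\<close>, which halves the later case distinctions.\<close>

lemma negated: "midpoint_equation I \<phi> (\<lambda>x. - f x) (\<lambda>x. - F x)"
proof
  fix x y assume "x \<in> I" "y \<in> I"
  from eq[OF this] show "\<phi> ((x + y) / 2) * (- f x - - f y) = - F x - - F y"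
    by (simp add: algebra_simps)
qed (rule interval open_I cont)+

text \<open>Near \<open>x\<close> the identity \<open>three_point\<close> can be divided by its
  left-hand coefficient, which exhibits \<open>f\<close> as a quotient of functions continuous at
  \<open>x\<close>.\<close>

lemma isCont_f:
  assumes "x \<in> I" "\<exists>y\<in>I. \<exists>z\<in>I. \<phi> ((x + y) / 2) \<noteq> \<phi> ((x + z) / 2)"
  shows "isCont f x"
proof -
  obtain y z where yz: "y \<in> I" "z \<in> I" "\<phi> ((x + y) / 2) \<noteq> \<phi> ((x + z) / 2)"
    using assms by auto
  let ?q = "\<lambda>t. ((\<phi> ((t + y) / 2) - \<phi> ((y + z) / 2)) * f y + (\<phi> ((y + z) / 2) - \<phi> ((t + z) / 2)) * f z)
    / (\<phi> ((t + y) / 2) - \<phi> ((t + z) / 2))"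
  note c = isCont_\<phi>_midpoint[OF assms(1) yz(1)] isCont_\<phi>_midpoint[OF assms(1) yz(2)]
  have q: "isCont ?q x" using yz by (intro continuous_intros c) auto
  have "isCont (\<lambda>t. \<phi> ((t + y) / 2) - \<phi> ((t + z) / 2)) x" by (intro continuous_intros c)
  then have "\<forall>\<^sub>F t in at x. \<phi> ((t + y) / 2) - \<phi> ((t + z) / 2) \<noteq> 0"
    unfolding isCont_def by (rule tendsto_imp_eventually_ne) (use yz in simp)
  then have "\<forall>\<^sub>F t in nhds x. t \<in> I \<and> \<phi> ((t + y) / 2) - \<phi> ((t + z) / 2) \<noteq> 0"
    using eventually_in_I[OF assms(1)] assms(1) yz(3)
    by (simp add: eventually_nhds_conv_at eventually_conj_iff)
  then have "\<forall>\<^sub>F t in nhds x. f t = ?q t"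
    by (rule eventually_mono) (use three_point[OF _ yz(1,2)] in \<open>simp add: nonzero_eq_divide_eq\<close>)
  with q show ?thesis by (simp add: isCont_cong)
qed

text \<open>If \<open>f\<close> takes equal values at points arbitrarily close to \<open>p\<close>, then \<open>\<phi>\<close> has
  arbitrarily small periods near \<open>(p + q) / 2\<close> whenever \<open>f p \<noteq> f q\<close>.\<close>

lemma locally_constant_midpoints:
  assumes cf: "continuous_on I f" and p: "p \<in> I"
    and chords: "\<And>e. e > 0 \<Longrightarrow> \<exists>x y. x < y \<and> x \<in> I \<and> y \<in> I \<and> \<bar>x - p\<bar> < e \<and> \<bar>y - p\<bar> < e \<and> f x = f y"
    and q: "q \<in> I" "f q \<noteq> f p"
  shows "((\<lambda>t. \<phi> ((p + t) / 2)) has_real_derivative 0) (at q)"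
proof -
  have tend: "(f \<longlongrightarrow> f x) (nhds x)" if "x \<in> I" for x
    using cf open_I that by (simp add: continuous_on_eq_continuous_at isCont_def tendsto_at_iff_tendsto_nhds)
  obtain U V where UV: "open U" "open V" "f p \<in> U" "f q \<in> V" "U \<inter> V = {}"
    using hausdorff[of "f p" "f q"] q by auto
  have "\<forall>\<^sub>F x in nhds p. x \<in> I \<and> f x \<in> U"
    using topological_tendstoD[OF tend[OF p] UV(1,3)] eventually_nhds_in_open[OF open_I p]
    by (simp add: eventually_conj_iff)
  then obtain e1 where e1: "e1 > 0" "\<And>x. dist x p < e1 \<Longrightarrow> x \<in> I \<and> f x \<in> U"
    by (auto simp: eventually_nhds_metric)
  have "\<forall>\<^sub>F x in nhds q. x \<in> I \<and> f x \<in> V"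
    using topological_tendstoD[OF tend[OF q(1)] UV(2,4)] eventually_nhds_in_open[OF open_I q(1)]
    by (simp add: eventually_conj_iff)
  then obtain e2 where e2: "e2 > 0" "\<And>x. dist x q < e2 \<Longrightarrow> x \<in> I \<and> f x \<in> V"
    by (auto simp: eventually_nhds_metric)
  \<comment> \<open>The factor 4 leaves room for the reflected point \<open>z = 2 * m - x\<close>
    below: its distance to \<open>q\<close> is at most
    \<open>2 * \<bar>m - (p + q) / 2\<bar> + \<bar>x - p\<bar>\<close>, which is less than
    \<open>3 * e\<close>.\<close>
  define e where "e = min e1 e2 / 4"
  have e: "e > 0" "4 * e \<le> e1" "4 * e \<le> e2" using e1 e2 by (auto simp: e_def)
  define J where "J = ball ((p + q) / 2) e"
  have mid: "m \<in> I" if "m \<in> J" for m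
  proof -
    have "p + (m - (p + q) / 2) \<in> I" "q + (m - (p + q) / 2) \<in> I"
      using that e e1(2)[of "p + (m - (p + q) / 2)"] e2(2)[of "q + (m - (p + q) / 2)"]
      by (auto simp: J_def dist_real_def)
    from midpoint_mem[OF this] show ?thesis by (simp add: field_simps)
  qed
  have "\<phi> a = \<phi> b" if "a \<in> J" "b \<in> J" "a \<le> b" for a b
  proof (rule small_periods_imp_constant[OF _ _ _ that])
    show "is_interval J" by (simp add: J_def is_interval_ball_real)
    show "continuous_on J \<phi>" using cont mid by (blast intro: continuous_on_subset)
    fix r :: real assume "r > 0"
    with e obtain x y where xy: "x < y" "x \<in> I" "y \<in> I" "\<bar>x - p\<bar> < min r e" "\<bar>y - p\<bar> < min r e" "f x = f y"
      using chords[of "min r e"] by auto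
    have "\<phi> (m + (y - x) / 2) = \<phi> m" if m: "m \<in> J" for m
    proof -
      \<comment> \<open>The reflection of \<open>x\<close> in \<open>m\<close> lies near
        \<open>q\<close>, so \<open>f x \<noteq> f z\<close>. Exchanging \<open>x\<close> for
        \<open>y\<close> preserves the values of \<open>f\<close> and \<open>F\<close> but moves the
        midpoint by \<open>(y - x) / 2\<close>, which is therefore a period of
        \<open>\<phi>\<close>.\<close>
      define z where "z = 2 * m - x"
      have "\<bar>m - (p + q) / 2\<bar> < e" "\<bar>x - p\<bar> < e" using m xy by (auto simp: J_def dist_real_def)
      then have b: "m - (p + q) / 2 < e" "(p + q) / 2 - m < e" "x - p < e" "p - x < e"
        by (auto simp: abs_less_iff)
      have "2 * m - x - q < 4 * e" "x + q - 2 * m < 4 * e" using b e(1) by (simp_all add: field_simps)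
      then have "dist z q < e2" "dist x p < e1" using b e by (auto simp: z_def dist_real_def)
      then have "z \<in> I" "f x \<in> U" "f z \<in> V" using e1(2) e2(2) by auto
      with UV(5) have z: "z \<in> I" "f x \<noteq> f z" by auto
      have "\<phi> ((x + z) / 2) * (f x - f z) = \<phi> ((y + z) / 2) * (f x - f z)"
        using eq[OF xy(2) z(1)] eq[OF xy(3) z(1)] xy(6) f_eq_imp_F_eq[OF xy(2,3,6)] by simp
      with z(2) have "\<phi> ((x + z) / 2) = \<phi> ((y + z) / 2)" by simp
      moreover have "(x + z) / 2 = m" "(y + z) / 2 = m + (y - x) / 2"
        by (simp_all add: z_def field_simps)
      ultimately show ?thesis by simp
    qed
    then show "\<exists>\<delta>. 0 < \<delta> \<and> \<delta> < r \<and> (\<forall>m. m \<in> J \<longrightarrow> m + \<delta> \<in> J \<longrightarrow> \<phi> (m + \<delta>) = \<phi> m)"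
      using xy by (intro exI[of _ "(y - x) / 2"]) auto
  qed
  then have const: "\<phi> a = \<phi> b" if "a \<in> J" "b \<in> J" for a b
    using that by (metis linear)
  have "\<forall>\<^sub>F t in nhds q. t \<in> ball q e" using e by (intro eventually_nhds_in_open) auto
  then have "\<forall>\<^sub>F t in nhds q. \<phi> ((p + t) / 2) = \<phi> ((p + q) / 2)"
    by (rule eventually_mono) (rule const, use e in \<open>auto simp: J_def dist_real_def abs_less_iff field_simps\<close>)
  from DERIV_cong_ev[OF refl this refl, of 0] show ?thesis by simp
qed

end

section \<open>Secant slopes at a point where \<open>f\<close> folds\<close>

locale fold_point = midpoint_equation +
  fixes p
  assumes cf: "continuous_on I f" and p: "p \<in> I"
    and chords: "\<And>e. e > 0 \<Longrightarrow> \<exists>x y. x < y \<and> x \<in> I \<and> y \<in> I \<and> \<bar>x - p\<bar> < e \<and> \<bar>y - p\<bar> < e \<and> f x = f y"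
begin

text \<open>By the equation, this is the slope of the secant of the plane curve
  \<open>(f, F)\<close> between the parameters \<open>p\<close> and \<open>q\<close>. If it is the
  same wherever \<open>f q \<noteq> f p\<close>, the curve lies on a line.\<close>

abbreviation slope where "slope q \<equiv> \<phi> ((p + q) / 2)"

lemma negated_fold: "fold_point I \<phi> (\<lambda>x. - f x) (\<lambda>x. - F x) p"
  unfolding fold_point_def fold_point_axioms_def
  using negated continuous_on_minus[OF cf] chords p by simp

lemma slope: "q \<in> I \<Longrightarrow> F q - F p = slope q * (f q - f p)"
  using eq[OF p, of q] by (simp add: algebra_simps)

lemma continuous_on_segment: "a \<in> I \<Longrightarrow> b \<in> I \<Longrightarrow> continuous_on {a..b} f"
  by (rule continuous_on_subset[OF cf]) (auto intro: between[of a b])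

lemma slope_const_on_segment:
  assumes "a \<in> I" "b \<in> I" "\<And>t. a \<le> t \<Longrightarrow> t \<le> b \<Longrightarrow> f t \<noteq> f p" "a \<le> b"
  shows "slope a = slope b"
proof (cases "a = b")
  case False
  with assms have ab: "a < b" by simp
  have d: "(slope has_real_derivative 0) (at x)" if "a \<le> x" "x \<le> b" for x
    by (rule locally_constant_midpoints[OF cf p chords])
      (use between[OF assms(1,2) that] assms(3)[OF that] in auto)
  have "continuous_on {a..b} slope"
    by (intro continuous_at_imp_continuous_on ballI DERIV_isCont[OF d]) auto
  from DERIV_isconst_end[OF ab this d] show ?thesis by simp
qed simp

text \<open>Equal values of \<open>f\<close> force equal values of \<open>F\<close>, hence the same
  point of the curve and the same secant.\<close>

lemma slope_eq_of_f_eq: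
  assumes "x \<in> I" "y \<in> I" "f x = f y" "f x \<noteq> f p"
  shows "slope x = slope y"
proof -
  have "slope x * (f y - f p) = slope y * (f y - f p)"
    using slope[OF assms(1), unfolded f_eq_imp_F_eq[OF assms(1-3)] assms(3)] slope[OF assms(2)]
    by (rule trans[OF sym])
  with assms(3,4) show ?thesis by simp
qed

text \<open>On the way from \<open>p\<close> to \<open>x\<close>, \<open>f\<close> passes the level
  \<open>f y\<close>. From the hit nearest to \<open>x\<close> onward it stays above
  \<open>f p\<close>, so the slope does not change up to \<open>x\<close>; at the hit it equals the
  slope at \<open>y\<close>, wherever \<open>y\<close> lies.\<close>

lemma slope_eq_above:
  assumes x: "x \<in> I" and y: "y \<in> I" "f p < f y" "f y \<le> f x"
  shows "slope x = slope y"
proof (cases "p \<le> x")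
  case True
  obtain t where t: "p \<le> t" "t \<le> x" "f t = f y" "\<And>u. t < u \<Longrightarrow> u \<le> x \<Longrightarrow> f y < f u"
    using last_hit[OF True continuous_on_segment[OF p x], of "f y"] y by (metis less_imp_le)
  have tI: "t \<in> I" using between p x t by blast
  have "f u \<noteq> f p" if "t \<le> u" "u \<le> x" for u
    using t(3) t(4)[of u] that y by (cases "u = t") auto
  then have "slope t = slope x" using slope_const_on_segment[OF tI x] t by blast
  moreover have "slope t = slope y" using slope_eq_of_f_eq[OF tI y(1)] t y by simp
  ultimately show ?thesis by simp
next
  case False
  then have "x \<le> p" by simp
  from first_hit[OF this continuous_on_segment[OF x p], of "f y"] y
  obtain t where t: "x \<le> t" "t \<le> p" "f t = f y" "\<And>u. x \<le> u \<Longrightarrow> u < t \<Longrightarrow> f y < f u"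
    by (metis less_imp_le)
  have tI: "t \<in> I" using between p x t by blast
  have "f u \<noteq> f p" if "x \<le> u" "u \<le> t" for u
    using t(3) t(4)[of u] that y by (cases "u = t") auto
  then have "slope x = slope t" using slope_const_on_segment[OF x tI] t by blast
  moreover have "slope t = slope y" using slope_eq_of_f_eq[OF tI y(1)] t y by simp
  ultimately show ?thesis by simp
qed

text \<open>Here every segment from \<open>x\<close> to \<open>y\<close> meets the level
  \<open>f p\<close>, so the slope cannot be carried along it. Instead both slopes are identified
  with the single value \<open>\<phi> ((s + t) / 2)\<close>, where \<open>s\<close> and
  \<open>t\<close> are the first and last points of that level between \<open>x\<close> and
  \<open>y\<close>.\<close>

lemma slope_eq_across:
  assumes x: "x \<in> I" "f p < f x" and y: "y \<in> I" "f y < f p" and xy: "x < y"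
  shows "slope x = slope y"
proof -
  have cxy: "continuous_on {x..y} f" by (rule continuous_on_segment[OF x(1) y(1)])
  obtain s where s: "x \<le> s" "s \<le> y" "f s = f p" "\<And>u. x \<le> u \<Longrightarrow> u < s \<Longrightarrow> f p < f u"
    using first_hit[OF _ cxy, of "f p"] x y xy by (metis less_imp_le)
  obtain t where t: "x \<le> t" "t \<le> y" "- f t = - f p" "\<And>u. t < u \<Longrightarrow> u \<le> y \<Longrightarrow> - f p < - f u"
    using last_hit[OF _ continuous_on_minus[OF cxy], of "- f p"] x y xy by (metis less_imp_le neg_le_iff_le)
  have sI: "s \<in> I" and tI: "t \<in> I" using between x y s t by blast+
  have Fs: "F s = F p" and Ft: "F t = F p" 
    using f_eq_imp_F_eq[OF sI p s(3)] f_eq_imp_F_eq[OF tI p] t(3) by auto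
  have xs: "x < s" and ty: "t < y" using x y s(1,3) t(2,3) by (auto simp: order.strict_iff_order)
  \<comment> \<open>Since \<open>f\<close> and \<open>F\<close> take the same values at
    \<open>t\<close> and at \<open>p\<close>, the point \<open>t\<close> can replace
    \<open>p\<close> as the base of the secant; in claim \<open>2\<close> the point \<open>s\<close>
    does.\<close>
  have 1: "\<phi> ((u + t) / 2) = slope x" if u: "x \<le> u" "u < s" for u
  proof -
    have uI: "u \<in> I" using between x sI u by (meson less_imp_le)
    have "slope x = slope u" 
      by (rule slope_const_on_segment[OF x(1) uI]) (use s(4) u in force)+
    moreover have "\<phi> ((u + t) / 2) * (f u - f p) = slope u * (f u - f p)"
      using eq[OF uI tI] slope[OF uI] Ft t(3) by simp
    ultimately show ?thesis using s(4)[OF u] by simp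
  qed
  have below: "f v \<noteq> f p" if "t < v" "v \<le> y" for v using t(4)[OF that] by simp
  have 2: "\<phi> ((u + s) / 2) = slope y" if u: "t < u" "u \<le> y" for u
  proof -
    have uI: "u \<in> I" using between y tI u by (meson less_imp_le)
    have "slope u = slope y" 
      by (rule slope_const_on_segment[OF uI y(1)]) (use below u in auto)
    moreover have "\<phi> ((u + s) / 2) * (f u - f p) = slope u * (f u - f p)"
      using eq[OF uI sI] slope[OF uI] Fs s(3) by simp
    ultimately show ?thesis using t(4)[OF u] by simp
  qed
  \<comment> \<open>By continuity, letting \<open>u\<close> tend to \<open>s\<close> from the left
    in \<open>1\<close>, and to \<open>t\<close> from the right in \<open>2\<close>, leads to the
    same midpoint.\<close>
  have "\<phi> ((s + t) / 2) = slope x"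
  proof (rule tendsto_unique)
    show "((\<lambda>u. \<phi> ((u + t) / 2)) \<longlongrightarrow> \<phi> ((s + t) / 2)) (at_left s)"
      using isCont_\<phi>_midpoint[OF sI tI] unfolding isCont_def by (rule tendsto_within_subset) simp
    have "\<forall>\<^sub>F u in at_left s. \<phi> ((u + t) / 2) = slope x"
      using eventually_at_left_real[OF xs] by eventually_elim (use 1 in auto)
    then show "((\<lambda>u. \<phi> ((u + t) / 2)) \<longlongrightarrow> slope x) (at_left s)"
      by (rule tendsto_eventually)
  qed simp
  moreover have "\<phi> ((t + s) / 2) = slope y"
  proof (rule tendsto_unique)
    show "((\<lambda>u. \<phi> ((u + s) / 2)) \<longlongrightarrow> \<phi> ((t + s) / 2)) (at_right t)"
      using isCont_\<phi>_midpoint[OF tI sI] unfolding isCont_def by (rule tendsto_within_subset) simp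
    have "\<forall>\<^sub>F u in at_right t. \<phi> ((u + s) / 2) = slope y"
      using eventually_at_right_real[OF ty] by eventually_elim (use 2 in auto)
    then show "((\<lambda>u. \<phi> ((u + s) / 2)) \<longlongrightarrow> slope y) (at_right t)"
      by (rule tendsto_eventually)
  qed simp
  ultimately show ?thesis by (simp add: add.commute)
qed

lemma slope_eq:
  assumes "x \<in> I" "f x \<noteq> f p" "y \<in> I" "f y \<noteq> f p"
  shows "slope x = slope y"
proof -
  interpret neg: fold_point I \<phi> "\<lambda>x. - f x" "\<lambda>x. - F x" p by (rule negated_fold)
  have above: "slope x = slope y" if "x \<in> I" "y \<in> I" "f p < f x" "f p < f y" for x y
    using slope_eq_above[of x y] slope_eq_above[of y x] that by (cases "f y \<le> f x") auto
  have below: "slope x = slope y" if "x \<in> I" "y \<in> I" "f x < f p" "f y < f p" for x y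
    using neg.slope_eq_above[of x y] neg.slope_eq_above[of y x] that by (cases "f x \<le> f y") auto
  have across: "slope x = slope y" if "x \<in> I" "y \<in> I" "f p < f x" "f y < f p" for x y
  proof (cases "x < y")
    case True
    then show ?thesis using slope_eq_across[of x y] that by simp
  next
    case False
    \<comment> \<open>Now the point below the level is on the left. For \<open>- f\<close> it lies
      above, which is the order that \<open>slope_eq_across\<close> treats.\<close>
    then have "y < x" using that by (cases "x = y") auto
    then show ?thesis using neg.slope_eq_across[of y x] that by simp
  qed
  consider "f p < f x" "f p < f y" | "f p < f x" "f y < f p" | "f x < f p" "f p < f y"
    | "f x < f p" "f y < f p"
    using assms by linarith
  then show ?thesis
  proof cases
    case 1 then show ?thesis by (rule above[OF assms(1,3)])
  next
    case 2 then show ?thesis by (rule across[OF assms(1,3)])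
  next
    case 3 then show ?thesis by (intro across[OF assms(3,1), symmetric])
  next
    case 4 then show ?thesis by (rule below[OF assms(1,3)])
  qed
qed

lemma affine: "\<exists>A \<mu>. \<forall>x\<in>I. F x = A * f x + \<mu>"
proof (cases "\<exists>q\<in>I. f q \<noteq> f p")
  case True
  then obtain q where q: "q \<in> I" "f q \<noteq> f p" by auto
  have "F x - F p = slope q * (f x - f p)" if "x \<in> I" for x
    using slope[OF that] slope_eq[OF that _ q] by (cases "f x = f p") auto
  then have "\<forall>x\<in>I. F x = slope q * f x + (F p - slope q * f p)" by (force simp: algebra_simps)
  then show ?thesis by blast
next
  case False
  then have "\<forall>x\<in>I. F x = 0 * f x + F p" using f_eq_imp_F_eq[OF _ p] by auto
  then show ?thesis by blast
qed

end

context midpoint_equation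
begin

lemma noninjective_imp_affine:
  assumes cf: "continuous_on I f" and "\<not> inj_on f I"
  shows "\<exists>A \<mu>. \<forall>x\<in>I. F x = A * f x + \<mu>"
proof -
  obtain a b where ab: "a \<in> I" "b \<in> I" "a < b" "f a = f b"
    using assms(2) by (metis inj_on_def linorder_neqE)
  have sub: "{a..b} \<subseteq> I" using between[OF ab(1,2)] by auto
  from small_chords[OF continuous_on_subset[OF cf sub] ab(3,4)]
  obtain p where p: "a \<le> p" "p \<le> b"
    "\<And>e. e > 0 \<Longrightarrow> \<exists>x y. x < y \<and> a \<le> x \<and> y \<le> b \<and> \<bar>x - p\<bar> < e \<and> \<bar>y - p\<bar> < e \<and> f x = f y"
    by metis
  interpret fold_point I \<phi> f F p
  proof
    show "continuous_on I f" by (rule cf)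
    show "p \<in> I" using p sub by auto
    fix e :: real assume "e > 0"
    from p(3)[OF this] obtain x y where xy: "x < y" "a \<le> x" "y \<le> b" "\<bar>x - p\<bar> < e" "\<bar>y - p\<bar> < e" "f x = f y"
      by auto
    then have "x \<in> I" "y \<in> I" using sub by auto
    with xy show "\<exists>x y. x < y \<and> x \<in> I \<and> y \<in> I \<and> \<bar>x - p\<bar> < e \<and> \<bar>y - p\<bar> < e \<and> f x = f y"
      by blast
  qed
  show ?thesis by (rule affine)
qed

end

section \<open>Continuously differentiable functions\<close>

text \<open>The class C^k with two-sided derivatives at every point of \<open>S\<close>, even if
  \<open>S\<close> is not open. Restriction to subsets is then immediate, while changing
  \<open>f\<close> off \<open>S\<close> calls for an open \<open>S\<close>.\<close>

primrec cont_diff :: "nat \<Rightarrow> real set \<Rightarrow> (real \<Rightarrow> real) \<Rightarrow> bool" where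
  "cont_diff 0 S f \<longleftrightarrow> continuous_on S f"
| "cont_diff (Suc k) S f \<longleftrightarrow>
    (\<exists>f'. (\<forall>x\<in>S. (f has_real_derivative f' x) (at x)) \<and> cont_diff k S f')"

lemma cont_diff_SucI:
  "(\<And>x. x \<in> S \<Longrightarrow> (f has_real_derivative f' x) (at x)) \<Longrightarrow> cont_diff k S f' \<Longrightarrow> cont_diff (Suc k) S f"
  by auto

lemma cont_diff_SucE:
  assumes "cont_diff (Suc k) S f"
  obtains f' where "\<And>x. x \<in> S \<Longrightarrow> (f has_real_derivative f' x) (at x)" "cont_diff k S f'"
  using assms by auto

lemma cont_diff_subset: "cont_diff k S f \<Longrightarrow> T \<subseteq> S \<Longrightarrow> cont_diff k T f"
proof (induction k arbitrary: f)
  case 0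
  then show ?case by (auto intro: continuous_on_subset)
next
  case (Suc k)
  from Suc.prems(1) obtain f' where f': "\<And>x. x \<in> S \<Longrightarrow> (f has_real_derivative f' x) (at x)" "cont_diff k S f'"
    by auto
  show ?case by (rule cont_diff_SucI[OF _ Suc.IH[OF f'(2) Suc.prems(2)]]) (use f' Suc.prems in auto)
qed

lemma cont_diff_Suc_imp: "cont_diff (Suc k) S f \<Longrightarrow> cont_diff k S f"
proof (induction k arbitrary: f)
  case 0
  then show ?case by (auto intro!: continuous_at_imp_continuous_on intro: DERIV_isCont)
next
  case (Suc k)
  from Suc.prems obtain f' where f': "\<And>x. x \<in> S \<Longrightarrow> (f has_real_derivative f' x) (at x)" "cont_diff (Suc k) S f'"
    by auto
  show ?case by (rule cont_diff_SucI[OF f'(1) Suc.IH[OF f'(2)]])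
qed

lemma cont_diff_imp_continuous_on: "cont_diff k S f \<Longrightarrow> continuous_on S f"
proof (induction k)
  case (Suc k)
  from Suc.IH[OF cont_diff_Suc_imp[OF Suc.prems]] show ?case .
qed simp

lemma cont_diff_cong:
  assumes "open S" "\<And>x. x \<in> S \<Longrightarrow> f x = g x" "cont_diff k S f"
  shows "cont_diff k S g"
proof (cases k)
  case 0
  then show ?thesis using assms by (simp cong: continuous_on_cong)
next
  case (Suc n)
  with assms(3) obtain f' where f': "\<And>x. x \<in> S \<Longrightarrow> (f has_real_derivative f' x) (at x)" "cont_diff n S f'"
    by (auto elim: cont_diff_SucE)
  have "(g has_real_derivative f' x) (at x)" if "x \<in> S" for x
    by (rule has_field_derivative_transform_within_open[OF f'(1)[OF that] assms(1) that assms(2)])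
  then show ?thesis unfolding Suc by (rule cont_diff_SucI[OF _ f'(2)])
qed

lemma cont_diff_const: "cont_diff k S (\<lambda>_. c)"
proof (induction k arbitrary: c)
  case (Suc k)
  show ?case by (rule cont_diff_SucI[OF _ Suc]) (rule DERIV_const)
qed simp

lemma cont_diff_add: "cont_diff k S f \<Longrightarrow> cont_diff k S g \<Longrightarrow> cont_diff k S (\<lambda>x. f x + g x)"
proof (induction k arbitrary: f g)
  case 0
  then show ?case by (simp add: continuous_on_add)
next
  case (Suc k)
  obtain f' where f': "\<And>x. x \<in> S \<Longrightarrow> (f has_real_derivative f' x) (at x)" "cont_diff k S f'"
    using Suc.prems(1) by auto
  obtain g' where g': "\<And>x. x \<in> S \<Longrightarrow> (g has_real_derivative g' x) (at x)" "cont_diff k S g'"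
    using Suc.prems(2) by auto
  show ?case by (rule cont_diff_SucI[OF DERIV_add[OF f'(1) g'(1)] Suc.IH[OF f'(2) g'(2)]])
qed

lemma cont_diff_mult: "cont_diff k S f \<Longrightarrow> cont_diff k S g \<Longrightarrow> cont_diff k S (\<lambda>x. f x * g x)"
proof (induction k arbitrary: f g)
  case 0
  then show ?case by (simp add: continuous_on_mult)
next
  case (Suc k)
  obtain f' where f': "\<And>x. x \<in> S \<Longrightarrow> (f has_real_derivative f' x) (at x)" "cont_diff k S f'"
    using Suc.prems(1) by auto
  obtain g' where g': "\<And>x. x \<in> S \<Longrightarrow> (g has_real_derivative g' x) (at x)" "cont_diff k S g'"
    using Suc.prems(2) by auto
  show ?case
    by (rule cont_diff_SucI[OF DERIV_mult[OF f'(1) g'(1)]], assumption, assumption,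
        intro cont_diff_add Suc.IH[OF f'(2) cont_diff_Suc_imp] Suc.IH[OF g'(2) cont_diff_Suc_imp] Suc.prems)
qed

lemma cont_diff_diff:
  assumes "cont_diff k S f" "cont_diff k S g"
  shows "cont_diff k S (\<lambda>x. f x - g x)"
  using cont_diff_add[OF assms(1) cont_diff_mult[OF cont_diff_const[of _ _ "-1"] assms(2)]] by simp

text \<open>The derivative is written as a product of \<open>f'\<close> and two factors
  \<open>inverse (f x)\<close>, so that the induction hypothesis covers it.\<close>

lemma cont_diff_inverse:
  "cont_diff k S f \<Longrightarrow> (\<And>x. x \<in> S \<Longrightarrow> f x \<noteq> 0) \<Longrightarrow> cont_diff k S (\<lambda>x. inverse (f x))"
proof (induction k)
  case 0
  then show ?case by (simp add: continuous_on_inverse)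
next
  case (Suc k)
  obtain f' where f': "\<And>x. x \<in> S \<Longrightarrow> (f has_real_derivative f' x) (at x)" "cont_diff k S f'"
    using Suc.prems(1) by auto
  have IH: "cont_diff k S (\<lambda>x. inverse (f x))"
    by (rule Suc.IH[OF cont_diff_Suc_imp[OF Suc.prems(1)] Suc.prems(2)])
  show ?case
  proof (rule cont_diff_SucI)
    fix x assume "x \<in> S"
    from DERIV_inverse'[OF f'(1)[OF this] Suc.prems(2)[OF this]]
    show "((\<lambda>x. inverse (f x)) has_real_derivative (-1) * (inverse (f x) * f' x * inverse (f x))) (at x)"
      by simp
  next
    show "cont_diff k S (\<lambda>x. - 1 * (inverse (f x) * f' x * inverse (f x)))"
      by (intro cont_diff_mult cont_diff_const IH f')
  qed
qed

lemma cont_diff_divide: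
  assumes "cont_diff k S f" "cont_diff k S g" "\<And>x. x \<in> S \<Longrightarrow> g x \<noteq> 0"
  shows "cont_diff k S (\<lambda>x. f x / g x)"
  using cont_diff_mult[OF assms(1) cont_diff_inverse[OF assms(2,3)]] by (simp add: divide_inverse)

lemma cont_diff_affine:
  "cont_diff k S f \<Longrightarrow> (\<And>x. x \<in> T \<Longrightarrow> c * x + d \<in> S) \<Longrightarrow> cont_diff k T (\<lambda>x. f (c * x + d))"
proof (induction k arbitrary: f)
  case 0
  then show ?case by (auto intro!: continuous_on_compose2[of S f] continuous_intros)
next
  case (Suc k)
  obtain f' where f': "\<And>x. x \<in> S \<Longrightarrow> (f has_real_derivative f' x) (at x)" "cont_diff k S f'"
    using Suc.prems(1) by auto
  show ?case
  proof (rule cont_diff_SucI)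
    fix x assume "x \<in> T"
    have "((\<lambda>x. c * x + d) has_real_derivative c) (at x)"
      by (auto intro!: derivative_eq_intros)
    from DERIV_chain2[OF f'(1)[OF Suc.prems(2)[OF \<open>x \<in> T\<close>]] this]
    show "((\<lambda>x. f (c * x + d)) has_real_derivative f' (c * x + d) * c) (at x)" .
  next
    show "cont_diff k T (\<lambda>x. f' (c * x + d) * c)"
      by (intro cont_diff_mult cont_diff_const Suc.IH f' Suc.prems)
  qed
qed

lemma cont_diff_shift:
  assumes "cont_diff k S f" "\<And>x. x \<in> T \<Longrightarrow> x + d \<in> S"
  shows "cont_diff k T (\<lambda>x. f (x + d))"
  using cont_diff_affine[OF assms(1), of T 1 d] assms(2) by simp

text \<open>The derivatives given on different neighbourhoods glue together because each of them
  agrees with the canonical function \<open>deriv f\<close>.\<close>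

lemma cont_diff_local:
  assumes "\<And>x. x \<in> S \<Longrightarrow> \<exists>U. open U \<and> x \<in> U \<and> cont_diff k U f"
  shows "cont_diff k S f"
  using assms
proof (induction k arbitrary: f)
  case 0
  have "isCont f x" if "x \<in> S" for x
    using 0[OF that] by (auto simp: continuous_on_eq_continuous_at)
  then show ?case by (simp add: continuous_at_imp_continuous_on)
next
  case (Suc k)
  have loc: "(f has_real_derivative deriv f x) (at x) \<and> (\<exists>U. open U \<and> x \<in> U \<and> cont_diff k U (deriv f))"
    if x: "x \<in> S" for x
  proof -
    obtain U where U: "open U" "x \<in> U" "cont_diff (Suc k) U f" using Suc.prems[OF x] by auto
    obtain f' where f': "\<And>x. x \<in> U \<Longrightarrow> (f has_real_derivative f' x) (at x)" "cont_diff k U f'"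
      using U(3) by auto
    have d: "f' y = deriv f y" if "y \<in> U" for y using DERIV_imp_deriv[OF f'(1)[OF that]] by simp
    from cont_diff_cong[OF U(1) d f'(2)] f'(1)[OF U(2)] d[OF U(2)] U show ?thesis by auto
  qed
  show ?case by (rule cont_diff_SucI[of _ _ "deriv f"]) (use loc Suc.IH[of "deriv f"] in blast)+
qed

lemma zero_derivative_imp_constant:
  fixes g :: "real \<Rightarrow> real"
  assumes I: "is_interval I" and d: "\<And>x. x \<in> I \<Longrightarrow> (g has_real_derivative 0) (at x)"
  obtains c where "\<And>x. x \<in> I \<Longrightarrow> g x = c"
proof -
  have "\<exists>c. \<forall>x\<in>I. g x = c"
    using I by (intro has_field_derivative_zero_constant is_interval_convex) (auto intro: has_field_derivative_at_within d)
  with that show thesis by blast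
qed

section \<open>The equation \<open>g'' = \<gamma> g\<close>\<close>

text \<open>The solution of \<open>g'' = \<gamma> * g\<close> with \<open>g 0 = 1\<close> and
  \<open>g' 0 = 0\<close>, which allows one argument for all signs of
  \<open>\<gamma>\<close>.\<close>

definition cosine :: "real \<Rightarrow> real \<Rightarrow> real" where
  "cosine \<gamma> x = (if \<gamma> < 0 then cos (sqrt (- \<gamma>) * x) else if \<gamma> = 0 then 1 else cosh (sqrt \<gamma> * x))"

text \<open>The solution with \<open>g 0 = 0\<close> and \<open>g' 0 = 1\<close>; dividing by the
  root makes \<open>cosine \<gamma>\<close> its derivative for every
  \<open>\<gamma>\<close>.\<close>

definition sine :: "real \<Rightarrow> real \<Rightarrow> real" where
  "sine \<gamma> x = (if \<gamma> < 0 then sin (sqrt (- \<gamma>) * x) / sqrt (- \<gamma>) else if \<gamma> = 0 then x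
    else sinh (sqrt \<gamma> * x) / sqrt \<gamma>)"

lemma DERIV_sine: "(sine \<gamma> has_real_derivative cosine \<gamma> x) (at x)"
proof -
  consider "\<gamma> < 0" | "\<gamma> = 0" | "\<gamma> > 0" by linarith
  then show ?thesis
    by cases (auto simp: sine_def[abs_def] cosine_def[abs_def] mult.assoc intro!: derivative_eq_intros)
qed

lemma DERIV_cosine: "(cosine \<gamma> has_real_derivative \<gamma> * sine \<gamma> x) (at x)"
proof -
  consider "\<gamma> < 0" | "\<gamma> = 0" | "\<gamma> > 0" by linarith
  then show ?thesis
    by cases (auto simp: sine_def[abs_def] cosine_def[abs_def] nonzero_eq_divide_eq mult.assoc
        intro!: derivative_eq_intros)
qed

lemma cosine_sine_pythagoras: "(cosine \<gamma> x)\<^sup>2 - \<gamma> * (sine \<gamma> x)\<^sup>2 = 1"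
proof -
  consider "\<gamma> < 0" | "\<gamma> = 0" | "\<gamma> > 0" by linarith
  then show ?thesis
    by cases (auto simp: sine_def cosine_def power_divide cosh_square_eq)
qed

text \<open>Two combinations of \<open>g\<close> and \<open>g'\<close> have derivative zero; they
  are the constants \<open>b\<close> and \<open>a\<close>. The Pythagorean identity inverts this
  linear system and recovers \<open>g\<close>. The interval need not contain 0.\<close>

lemma second_order_ode:
  fixes g :: "real \<Rightarrow> real"
  assumes I: "is_interval I"
    and g: "\<And>x. x \<in> I \<Longrightarrow> (g has_real_derivative g' x) (at x)"
      "\<And>x. x \<in> I \<Longrightarrow> (g' has_real_derivative \<gamma> * g x) (at x)"
  obtains a b where "\<And>x. x \<in> I \<Longrightarrow> g x = a * sine \<gamma> x + b * cosine \<gamma> x"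
proof -
  have "((\<lambda>x. g x * cosine \<gamma> x - g' x * sine \<gamma> x) has_real_derivative 0) (at x)" if "x \<in> I" for x
    by (rule derivative_eq_intros g that DERIV_sine DERIV_cosine refl)+ (simp add: algebra_simps)
  from zero_derivative_imp_constant[OF I this] obtain b
    where b: "\<And>x. x \<in> I \<Longrightarrow> g x * cosine \<gamma> x - g' x * sine \<gamma> x = b" by blast
  have "((\<lambda>x. g' x * cosine \<gamma> x - \<gamma> * (g x * sine \<gamma> x)) has_real_derivative 0) (at x)" if "x \<in> I" for x
    by (rule derivative_eq_intros g that DERIV_sine DERIV_cosine refl)+ (simp add: algebra_simps)
  from zero_derivative_imp_constant[OF I this] obtain a
    where a: "\<And>x. x \<in> I \<Longrightarrow> g' x * cosine \<gamma> x - \<gamma> * (g x * sine \<gamma> x) = a" by blast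
  have "g x = a * sine \<gamma> x + b * cosine \<gamma> x" if "x \<in> I" for x
  proof -
    have "g x = g x * ((cosine \<gamma> x)\<^sup>2 - \<gamma> * (sine \<gamma> x)\<^sup>2)" by (simp add: cosine_sine_pythagoras)
    also have "\<dots> = a * sine \<gamma> x + b * cosine \<gamma> x"
      by (simp add: a[OF that, symmetric] b[OF that, symmetric] power2_eq_square algebra_simps)
    finally show ?thesis .
  qed
  with that show thesis by blast
qed

section \<open>Injective \<open>f\<close>\<close>

lemma three_derivatives:
  assumes "cont_diff (Suc (Suc (Suc 0))) S g"
  obtains g1 g2 g3 where "\<And>x. x \<in> S \<Longrightarrow> (g has_real_derivative g1 x) (at x)"
    "\<And>x. x \<in> S \<Longrightarrow> (g1 has_real_derivative g2 x) (at x)"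
    "\<And>x. x \<in> S \<Longrightarrow> (g2 has_real_derivative g3 x) (at x)"
proof -
  obtain g1 g2 g3 where "\<forall>x\<in>S. (g has_real_derivative g1 x) (at x)"
    "\<forall>x\<in>S. (g1 has_real_derivative g2 x) (at x)" "\<forall>x\<in>S. (g2 has_real_derivative g3 x) (at x)"
    using assms by auto
  with that[of g1 g2 g3] show thesis by simp
qed

lemma local_antiderivative:
  fixes f :: "real \<Rightarrow> real"
  assumes "continuous_on (cball x r) f"
  obtains g where "\<And>t. t \<in> ball x r \<Longrightarrow> (g has_real_derivative f t) (at t)"
proof -
  have "continuous_on {x - r..x + r} f" using assms by (simp add: cball_eq_atLeastAtMost)
  from antiderivative_continuous[OF this]
  obtain g where g: "\<And>t. t \<in> {x - r..x + r} \<Longrightarrow> (g has_vector_derivative f t) (at t within {x - r..x + r})"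
    by metis
  have "(g has_real_derivative f t) (at t)" if "t \<in> ball x r" for t
  proof -
    have t: "t \<in> {x - r<..<x + r}" using that by (auto simp: dist_real_def abs_less_iff)
    then have "(g has_vector_derivative f t) (at t within {x - r<..<x + r})"
      by (intro has_vector_derivative_within_subset[OF g]) auto
    with t show ?thesis
      by (simp add: has_real_derivative_iff_has_vector_derivative at_within_open[OF t])
  qed
  with that show thesis by blast
qed

text \<open>The assumption \<open>nonconst\<close> excludes the case settled by
  \<open>constant_midpoints_imp_affine\<close>.\<close>

locale injective_midpoint = midpoint_equation +
  assumes nonempty: "I \<noteq> {}" and inj: "inj_on f I" and cf: "continuous_on I f"
    and nonconst: "\<And>x. x \<in> I \<Longrightarrow> \<exists>y\<in>I. \<exists>z\<in>I. \<phi> ((x + y) / 2) \<noteq> \<phi> ((x + z) / 2)"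
begin

text \<open>Integrating the equation in \<open>d\<close> at \<open>x = m + d, y = m - d\<close> exhibits \<open>\<phi>\<close> locally as a
  quotient of second differences of antiderivatives of \<open>F\<close> and \<open>f\<close>; the denominator
  vanishes nowhere because \<open>f\<close> is injective.\<close>

lemma gain_\<phi>:
  assumes f: "cont_diff k I f" and F: "cont_diff k I F"
  shows "cont_diff (Suc k) I \<phi>"
proof (rule cont_diff_local)
  fix x assume x: "x \<in> I"
  obtain r where r: "r > 0" "cball x r \<subseteq> I" using open_I x by (auto simp: open_contains_cball)
  have sub: "ball x r \<subseteq> I" using r by auto
  obtain f1 where f1: "\<And>t. t \<in> ball x r \<Longrightarrow> (f1 has_real_derivative f t) (at t)"
    using local_antiderivative[OF continuous_on_subset[OF cf r(2)]] by blast
  obtain F1 where F1: "\<And>t. t \<in> ball x r \<Longrightarrow> (F1 has_real_derivative F t) (at t)"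
    using local_antiderivative[OF continuous_on_subset[OF cont_diff_imp_continuous_on[OF F] r(2)]] by blast
  have C: "cont_diff (Suc k) (ball x r) f1" "cont_diff (Suc k) (ball x r) F1"
    by (rule cont_diff_SucI[OF f1 cont_diff_subset[OF f sub]], assumption,
        rule cont_diff_SucI[OF F1 cont_diff_subset[OF F sub]])
  \<comment> \<open>Halving the radius keeps \<open>m + d\<close> and \<open>m - d\<close> inside
    \<open>ball x r\<close> for all \<open>m\<close> in \<open>U\<close>.\<close>
  define d U where "d = r / 2" and "U = ball x (r / 2)"
  have d: "d > 0" using r by (simp add: d_def)
  have mem: "m + t \<in> ball x r" if "m \<in> U" "\<bar>t\<bar> \<le> d" for m t
  proof -
    have "\<bar>x - m - t\<bar> \<le> \<bar>x - m\<bar> + \<bar>t\<bar>" by (rule abs_triangle_ineq4)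
    also have "\<dots> < r / 2 + r / 2"
      using that by (intro add_less_le_mono) (auto simp: U_def d_def dist_real_def)
    finally show ?thesis by (simp add: dist_real_def algebra_simps)
  qed
  define P Q where "P = (\<lambda>m. F1 (m + d) + F1 (m + - d) - 2 * F1 m)"
    and "Q = (\<lambda>m. f1 (m + d) + f1 (m + - d) - 2 * f1 m)"
  have PQ: "Q m \<noteq> 0 \<and> \<phi> m = P m / Q m" if m: "m \<in> U" for m
  proof -
    have mt: "m + t \<in> ball x r" "m - t \<in> ball x r" "m + t \<in> I" "m - t \<in> I" if "0 \<le> t" "t \<le> d" for t
      using mem[OF m, of t] mem[OF m, of "- t"] that sub by auto
    have shift: "((\<lambda>t. g (m + t) + g (m - t) - 2 * g m) has_real_derivative g' (m + t) - g' (m - t)) (at t)"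
      if "\<And>t. t \<in> ball x r \<Longrightarrow> (g has_real_derivative g' t) (at t)" "0 \<le> t" "t \<le> d" for g g' t
      by (rule derivative_eq_intros DERIV_chain2[OF that(1)] mt that refl)+ simp
    \<comment> \<open>The second difference of \<open>f1\<close> vanishes at step 0, so by the mean
      value theorem \<open>Q m\<close> equals \<open>d * (f (m + s) - f (m - s))\<close>, which is
      nonzero by injectivity.\<close>
    obtain s where s: "0 < s" "s < d" "(f1 (m + d) + f1 (m - d) - 2 * f1 m) - (f1 (m + 0) + f1 (m - 0) - 2 * f1 m)
      = (d - 0) * (f (m + s) - f (m - s))"
      using MVT2[OF d shift[OF f1]] by blast
    have "f (m + s) \<noteq> f (m - s)"
      using inj_onD[OF inj _ mt(3,4)[of s]] s by auto
    with s(3) d have "Q m \<noteq> 0" by (auto simp: Q_def)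
    \<comment> \<open>The equation at \<open>m + t\<close> and \<open>m - t\<close> says that
      \<open>H\<close> has derivative zero; as \<open>H 0 = 0\<close>, also
      \<open>H d = 0\<close>.\<close>
    define H where "H t = \<phi> m * (f1 (m + t) + f1 (m - t) - 2 * f1 m) - (F1 (m + t) + F1 (m - t) - 2 * F1 m)" for t
    have "(H has_real_derivative 0) (at t)" if t: "0 \<le> t" "t \<le> d" for t
    proof -
      have "\<phi> m * (f (m + t) - f (m - t)) - (F (m + t) - F (m - t)) = 0"
        using eq[OF mt(3,4)[OF t]] by simp
      with DERIV_diff[OF DERIV_cmult[OF shift[OF f1 t], of "\<phi> m"] shift[OF F1 t]]
      show ?thesis unfolding H_def[abs_def] by simp
    qed
    from MVT2[OF d this] have "H d = H 0" by auto
    then have "\<phi> m * Q m = P m" by (simp add: H_def P_def Q_def)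
    with \<open>Q m \<noteq> 0\<close> show ?thesis by (simp add: nonzero_eq_divide_eq)
  qed
  have "m \<in> ball x r" if "m \<in> U" for m using mem[OF that, of 0] d by simp
  then have sub': "U \<subseteq> ball x r" by blast
  have C': "cont_diff (Suc k) U P" "cont_diff (Suc k) U Q"
    unfolding P_def Q_def
    by (intro cont_diff_diff cont_diff_add cont_diff_mult cont_diff_const cont_diff_subset[OF _ sub'] C
        cont_diff_shift[OF C(1)] cont_diff_shift[OF C(2)] mem; use d in simp)+
  have "cont_diff (Suc k) U (\<lambda>m. P m / Q m)"
    by (rule cont_diff_divide[OF C']) (use PQ in blast)
  moreover have "open U" "x \<in> U" using r by (auto simp: U_def)
  ultimately show "\<exists>U. open U \<and> x \<in> U \<and> cont_diff (Suc k) U \<phi>"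
    using cont_diff_cong[of U "\<lambda>m. P m / Q m" \<phi> "Suc k"] PQ by metis
qed

lemma cont_diff_\<phi>_midpoint:
  assumes "cont_diff k I \<phi>" "y \<in> I"
  shows "cont_diff k I (\<lambda>t. \<phi> ((t + y) / 2))"
proof -
  have e: "1 / 2 * t + y / 2 = (t + y) / 2" for t by (simp add: field_simps)
  show ?thesis
    using cont_diff_affine[OF assms(1), of I "1/2" "y/2"] midpoint_mem[OF _ assms(2)] unfolding e by blast
qed

text \<open>The quotient from \<open>three_point\<close>, now read on an open set where its
  denominator has no zero.\<close>

lemma gain_f:
  assumes "cont_diff k I \<phi>"
  shows "cont_diff k I f"
proof (rule cont_diff_local)
  fix x assume x: "x \<in> I"
  obtain y z where yz: "y \<in> I" "z \<in> I" "\<phi> ((x + y) / 2) \<noteq> \<phi> ((x + z) / 2)"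
    using nonconst[OF x] by auto
  define U where "U = {t \<in> I. \<phi> ((t + y) / 2) - \<phi> ((t + z) / 2) \<noteq> 0}"
  note c = cont_diff_\<phi>_midpoint[OF assms yz(1)] cont_diff_\<phi>_midpoint[OF assms yz(2)]
  have "openin (top_of_set I) (I \<inter> (\<lambda>t. \<phi> ((t + y) / 2) - \<phi> ((t + z) / 2)) -` (- {0}))"
    by (intro continuous_openin_preimage_gen cont_diff_imp_continuous_on[OF cont_diff_diff[OF c]]) auto
  also have "I \<inter> (\<lambda>t. \<phi> ((t + y) / 2) - \<phi> ((t + z) / 2)) -` (- {0}) = U" by (auto simp: U_def)
  finally have U: "open U" using open_I by (simp add: openin_open_eq)
  have sub: "U \<subseteq> I" by (auto simp: U_def)
  let ?q = "\<lambda>t. ((\<phi> ((t + y) / 2) - \<phi> ((y + z) / 2)) * f y + (\<phi> ((y + z) / 2) - \<phi> ((t + z) / 2)) * f z)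
    / (\<phi> ((t + y) / 2) - \<phi> ((t + z) / 2))"
  have "cont_diff k U ?q"
    by (intro cont_diff_divide cont_diff_add cont_diff_mult cont_diff_diff cont_diff_const
        cont_diff_subset[OF c(1) sub] cont_diff_subset[OF c(2) sub]) (auto simp: U_def)
  moreover have "?q t = f t" if "t \<in> U" for t
    using three_point[OF _ yz(1,2), of t] that by (simp add: U_def nonzero_divide_eq_eq)
  ultimately have "cont_diff k U f" using cont_diff_cong[OF U, of ?q f k] by blast
  moreover have "x \<in> U" using x yz by (simp add: U_def)
  ultimately show "\<exists>U. open U \<and> x \<in> U \<and> cont_diff k U f" using U by blast
qed

text \<open>Fixing one argument of the equation expresses \<open>F\<close> through
  \<open>\<phi>\<close> and \<open>f\<close>.\<close>

lemma gain_F: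
  assumes "cont_diff k I \<phi>"
  shows "cont_diff k I F"
proof -
  obtain y where y: "y \<in> I" using nonempty by blast
  have "cont_diff k I (\<lambda>t. F y + \<phi> ((t + y) / 2) * (f t - f y))"
    by (intro cont_diff_add cont_diff_mult cont_diff_diff cont_diff_const
        cont_diff_\<phi>_midpoint gain_f assms y)
  then show ?thesis
    by (rule cont_diff_cong[OF open_I, rotated]) (use eq[OF _ y] in simp)
qed

lemma smooth: "cont_diff k I \<phi>"
proof (induction k)
  case 0
  then show ?case using cont by simp
next
  case (Suc k)
  show ?case by (intro gain_\<phi> gain_f gain_F Suc)
qed

section \<open>The differential equation for \<open>f'\<close> and \<open>F'\<close>\<close>

lemma differentiated:
  fixes s :: real
  assumes u: "\<And>x. x \<in> I \<Longrightarrow> (u has_real_derivative u' x) (at x)"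
    and U: "\<And>x. x \<in> I \<Longrightarrow> (U has_real_derivative U' x) (at x)"
    and e: "\<And>m d. m + d \<in> I \<Longrightarrow> m - d \<in> I \<Longrightarrow> \<phi> m * (u (m + d) + s * u (m - d)) = U (m + d) + s * U (m - d)"
    and md: "m + d \<in> I" "m - d \<in> I"
  shows "\<phi> m * (u' (m + d) + - s * u' (m - d)) = U' (m + d) + - s * U' (m - d)"
proof -
  \<comment> \<open>Differentiation is in \<open>d\<close> with \<open>m\<close> fixed; the chain
    rule at \<open>m - d\<close> turns \<open>s\<close> into \<open>- s\<close>. The conclusion thus
    has the form of hypothesis \<open>e\<close>, and the lemma can be iterated.\<close>
  have shift: "((\<lambda>t. g (m + t) + s * g (m - t)) has_real_derivative g' (m + d) + - s * g' (m - d)) (at d)"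
    if "\<And>x. x \<in> I \<Longrightarrow> (g has_real_derivative g' x) (at x)" for g g'
    by (rule derivative_eq_intros DERIV_chain2[OF that] md refl)+ simp
  have "open ((\<lambda>t. m + t) -` I \<inter> (\<lambda>t. m - t) -` I)"
    by (intro open_Int open_vimage open_I continuous_intros)
  from has_field_derivative_transform_within_open[OF DERIV_cmult[OF shift[of u u', OF u], of "\<phi> m"] this]
  have "((\<lambda>t. U (m + t) + s * U (m - t)) has_real_derivative \<phi> m * (u' (m + d) + - s * u' (m - d))) (at d)"
    using md e by simp
  from DERIV_unique[OF this shift[of U U', OF U]] show ?thesis .
qed

lemma ode:
  obtains \<gamma> f1 f2 F1 F2 where
    "\<And>x. x \<in> I \<Longrightarrow> (f has_real_derivative f1 x) (at x)"
    "\<And>x. x \<in> I \<Longrightarrow> (f1 has_real_derivative f2 x) (at x)"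
    "\<And>x. x \<in> I \<Longrightarrow> (f2 has_real_derivative \<gamma> * f1 x) (at x)"
    "\<And>x. x \<in> I \<Longrightarrow> (F has_real_derivative F1 x) (at x)"
    "\<And>x. x \<in> I \<Longrightarrow> (F1 has_real_derivative F2 x) (at x)"
    "\<And>x. x \<in> I \<Longrightarrow> (F2 has_real_derivative \<gamma> * F1 x) (at x)"
    "\<And>x. x \<in> I \<Longrightarrow> f1 x \<noteq> 0" "\<And>x. x \<in> I \<Longrightarrow> F1 x = \<phi> x * f1 x"
proof -
  note S = smooth[of "Suc (Suc (Suc 0))"]
  obtain f1 f2 f3 where f: "\<And>x. x \<in> I \<Longrightarrow> (f has_real_derivative f1 x) (at x)"
    "\<And>x. x \<in> I \<Longrightarrow> (f1 has_real_derivative f2 x) (at x)"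
    "\<And>x. x \<in> I \<Longrightarrow> (f2 has_real_derivative f3 x) (at x)"
    using three_derivatives[OF gain_f[OF S]] by metis
  obtain F1 F2 F3 where F: "\<And>x. x \<in> I \<Longrightarrow> (F has_real_derivative F1 x) (at x)"
    "\<And>x. x \<in> I \<Longrightarrow> (F1 has_real_derivative F2 x) (at x)"
    "\<And>x. x \<in> I \<Longrightarrow> (F2 has_real_derivative F3 x) (at x)"
    using three_derivatives[OF gain_F[OF S]] by metis
  obtain p1 p2 where p: "\<And>x. x \<in> I \<Longrightarrow> (\<phi> has_real_derivative p1 x) (at x)"
    "\<And>x. x \<in> I \<Longrightarrow> (p1 has_real_derivative p2 x) (at x)"
    using three_derivatives[OF S] by metis
  have e0: "\<phi> m * (f (m + d) + -1 * f (m - d)) = F (m + d) + -1 * F (m - d)"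
    if "m + d \<in> I" "m - d \<in> I" for m d
    using eq[OF that] by simp
  note e1 = differentiated[OF f(1) F(1) e0]
  note e2 = differentiated[OF f(2) F(2) e1]
  note e3 = differentiated[OF f(3) F(3) e2]
  \<comment> \<open>At \<open>d = 0\<close> the odd derivatives \<open>e1\<close> and
    \<open>e3\<close> carry a plus sign and give information, while \<open>e2\<close> reduces to
    \<open>0 = 0\<close>.\<close>
  have F1: "F1 x = \<phi> x * f1 x" if "x \<in> I" for x
    using e1[of x 0] that by simp
  have F3: "F3 x = \<phi> x * f3 x" if "x \<in> I" for x
    using e3[of x 0] that by simp
  have F2: "F2 x = p1 x * f1 x + f2 x * \<phi> x" if "x \<in> I" for x
  proof (rule DERIV_unique[OF F(2)[OF that]])
    show "(F1 has_real_derivative p1 x * f1 x + f2 x * \<phi> x) (at x)"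
      by (rule has_field_derivative_transform_within_open[OF DERIV_mult[OF p(1)[OF that] f(2)[OF that]] open_I that])
        (simp add: F1)
  qed
  \<comment> \<open>Differentiating \<open>F1 = \<phi> * f1\<close> twice gives a second expression
    for \<open>F3\<close>. Comparison with \<open>F3 = \<phi> * f3\<close> leaves
    \<open>key\<close>, which multiplied by \<open>f1\<close> is the derivative of
    \<open>p1 * f1 * f1\<close>.\<close>
  have F3': "F3 x = p2 x * f1 x + 2 * p1 x * f2 x + f3 x * \<phi> x" if "x \<in> I" for x
  proof -
    have "(F2 has_real_derivative (p2 x * f1 x + f2 x * p1 x) + (f3 x * \<phi> x + p1 x * f2 x)) (at x)"
      by (rule has_field_derivative_transform_within_open[OF DERIV_add[OF
            DERIV_mult[OF p(2)[OF that] f(2)[OF that]] DERIV_mult[OF f(3)[OF that] p(1)[OF that]]] open_I that])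
        (simp add: F2)
    from DERIV_unique[OF F(3)[OF that] this] show ?thesis by simp
  qed
  have key: "p2 x * f1 x + 2 * p1 x * f2 x = 0" if "x \<in> I" for x
    using F3[OF that] F3'[OF that] by simp
  have "((\<lambda>x. p1 x * (f1 x * f1 x)) has_real_derivative 0) (at x)" if "x \<in> I" for x
  proof -
    have "p2 x * (f1 x * f1 x) + (f2 x * f1 x + f2 x * f1 x) * p1 x = f1 x * (p2 x * f1 x + 2 * p1 x * f2 x)"
      by (simp add: algebra_simps)
    also have "\<dots> = 0" using key[OF that] by simp
    finally show ?thesis
      using DERIV_mult[OF p(2)[OF that] DERIV_mult[OF f(2)[OF that] f(2)[OF that]]] by simp
  qed
  from zero_derivative_imp_constant[OF interval this]
  obtain \<kappa> where \<kappa>: "\<And>x. x \<in> I \<Longrightarrow> p1 x * (f1 x * f1 x) = \<kappa>" by blast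
  obtain x0 where x0: "x0 \<in> I" using nonempty by blast
  \<comment> \<open>If the constant were 0, then \<open>f1\<close> would vanish wherever
    \<open>p1\<close> does not, on a whole interval by continuity, against injectivity of
    \<open>f\<close>. So \<open>p1\<close> would vanish identically and \<open>\<phi>\<close> would
    be constant.\<close>
  have "\<kappa> \<noteq> 0"
  proof
    assume 0: "\<kappa> = 0"
    have "p1 x = 0" if x: "x \<in> I" for x
    proof (rule ccontr)
      assume ne: "p1 x \<noteq> 0"
      have "isCont p1 x" by (rule DERIV_isCont[OF p(2)[OF x]])
      then have "\<forall>\<^sub>F t in at x. p1 t \<noteq> 0"
        unfolding isCont_def using ne by (rule tendsto_imp_eventually_ne)
      then have "\<forall>\<^sub>F t in nhds x. t \<in> I \<and> p1 t \<noteq> 0"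
        using eventually_in_I[OF x] x ne by (simp add: eventually_nhds_conv_at eventually_conj_iff)
      then obtain e where e: "e > 0" "\<And>t. dist t x < e \<Longrightarrow> t \<in> I \<and> p1 t \<noteq> 0"
        by (auto simp: eventually_nhds_metric)
      have tI: "t \<in> I" "f1 t = 0" if "x \<le> t" "t \<le> x + e / 2" for t
      proof -
        have "dist t x < e" using that e(1) by (simp add: dist_real_def)
        from e(2)[OF this] \<kappa>[of t] 0 show "t \<in> I" "f1 t = 0" by auto
      qed
      have "f (x + e / 2) - f x = (x + e / 2 - x) * 0"
        using MVT2[of x "x + e / 2" f f1] e(1) f(1) tI by fastforce
      then have "f (x + e / 2) = f x" by simp
      with inj_onD[OF inj this] tI[of x] tI[of "x + e / 2"] e(1) show False by simp
    qed
    then have "\<And>x. x \<in> I \<Longrightarrow> (\<phi> has_real_derivative 0) (at x)" using p(1) by fastforce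
    from zero_derivative_imp_constant[OF interval this]
    obtain c where "\<And>x. x \<in> I \<Longrightarrow> \<phi> x = c" by blast
    with nonconst[OF x0] midpoint_mem[OF x0] show False by simp
  qed
  then have f1: "f1 x \<noteq> 0" and p1: "p1 x \<noteq> 0" if "x \<in> I" for x
    using \<kappa>[OF that] by auto
  have \<phi>_ne: "\<phi> x \<noteq> \<phi> y" if xy: "x \<in> I" "y \<in> I" "x < y" for x y
  proof
    assume "\<phi> x = \<phi> y"
    have mem: "t \<in> I" if "x \<le> t" "t \<le> y" for t by (rule between[OF xy(1,2) that])
    obtain t where "x < t" "t < y" "\<phi> y - \<phi> x = (y - x) * p1 t"
      using MVT2[OF xy(3), of \<phi> p1] p(1) mem by blast
    with \<open>\<phi> x = \<phi> y\<close> p1[of t] mem[of t] show False by simp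
  qed
  have ratio: "f3 x * f1 y = f3 y * f1 x" if x: "x \<in> I" and y: "y \<in> I" for x y
  proof (cases "x = y")
    case False
    define m d where "m = (x + y) / 2" and "d = (x - y) / 2"
    have md: "m + d = x" "m - d = y" by (simp_all add: m_def d_def field_simps)
    have mI: "m \<in> I" unfolding m_def by (rule midpoint_mem[OF x y])
    have "\<phi> m * (f1 x + f1 y) = F1 x + F1 y" using e1[of m d] x y by (simp add: md)
    then have 1: "(\<phi> x - \<phi> m) * f1 x = (\<phi> m - \<phi> y) * f1 y"
      using F1[OF x] F1[OF y] by (simp add: algebra_simps)
    have "\<phi> m * (f3 x + f3 y) = F3 x + F3 y" using e3[of m d] x y by (simp add: md)
    then have 2: "(\<phi> x - \<phi> m) * f3 x = (\<phi> m - \<phi> y) * f3 y"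
      using F3[OF x] F3[OF y] by (simp add: algebra_simps)
    have "x < m \<or> m < x" using False by (auto simp: m_def)
    then have ne: "\<phi> x - \<phi> m \<noteq> 0" using \<phi>_ne[OF x mI] \<phi>_ne[OF mI x] by auto
    \<comment> \<open>Equations \<open>2\<close> and \<open>1\<close> are cross-multiplied; the
      common factor cancels because \<open>\<phi>\<close> separates \<open>x\<close> from the
      midpoint.\<close>
    have "(\<phi> x - \<phi> m) * (f3 x * f1 y) = ((\<phi> x - \<phi> m) * f3 x) * f1 y" by simp
    also have "\<dots> = ((\<phi> m - \<phi> y) * f1 y) * f3 y" unfolding 2 by simp
    also have "\<dots> = (\<phi> x - \<phi> m) * (f3 y * f1 x)" unfolding 1[symmetric] by simp
    finally show ?thesis using ne by simp
  qed simp
  define \<gamma> where "\<gamma> = f3 x0 / f1 x0"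
  have f3: "f3 x = \<gamma> * f1 x" if "x \<in> I" for x
    using ratio[OF that x0] f1[OF x0] by (simp add: \<gamma>_def field_simps)
  show thesis
  proof (rule that[of f1 f2 \<gamma> F1 F2])
    show "(f2 has_real_derivative \<gamma> * f1 x) (at x)" if "x \<in> I" for x
      using f(3)[OF that] f3[OF that] by simp
    show "(F2 has_real_derivative \<gamma> * F1 x) (at x)" if "x \<in> I" for x
      using F(3)[OF that] F3[OF that] F1[OF that] f3[OF that] by (simp add: mult.left_commute)
  qed (fact f F f1 F1)+
qed

section \<open>Explicit solutions from the differential equation\<close>

lemma normal_form:
  obtains \<gamma> a b c d where "a * d \<noteq> b * c"
    "\<And>x. x \<in> I \<Longrightarrow> a * sine \<gamma> x + b * cosine \<gamma> x \<noteq> 0"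
    "\<And>x. x \<in> I \<Longrightarrow> \<phi> x = (c * sine \<gamma> x + d * cosine \<gamma> x) / (a * sine \<gamma> x + b * cosine \<gamma> x)"
    "\<And>x. x \<in> I \<Longrightarrow> (f has_real_derivative a * sine \<gamma> x + b * cosine \<gamma> x) (at x)"
    "\<And>x. x \<in> I \<Longrightarrow> (F has_real_derivative c * sine \<gamma> x + d * cosine \<gamma> x) (at x)"
proof (rule ode)
  fix \<gamma> f1 f2 F1 F2
  assume o:
    "\<And>x. x \<in> I \<Longrightarrow> (f has_real_derivative f1 x) (at x)"
    "\<And>x. x \<in> I \<Longrightarrow> (f1 has_real_derivative f2 x) (at x)"
    "\<And>x. x \<in> I \<Longrightarrow> (f2 has_real_derivative \<gamma> * f1 x) (at x)"
    "\<And>x. x \<in> I \<Longrightarrow> (F has_real_derivative F1 x) (at x)"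
    "\<And>x. x \<in> I \<Longrightarrow> (F1 has_real_derivative F2 x) (at x)"
    "\<And>x. x \<in> I \<Longrightarrow> (F2 has_real_derivative \<gamma> * F1 x) (at x)"
    "\<And>x. x \<in> I \<Longrightarrow> f1 x \<noteq> 0" "\<And>x. x \<in> I \<Longrightarrow> F1 x = \<phi> x * f1 x"
  from second_order_ode[OF interval o(2,3)]
  obtain a b where ab: "\<And>x. x \<in> I \<Longrightarrow> f1 x = a * sine \<gamma> x + b * cosine \<gamma> x" by metis
  from second_order_ode[OF interval o(5,6)]
  obtain c d where cd: "\<And>x. x \<in> I \<Longrightarrow> F1 x = c * sine \<gamma> x + d * cosine \<gamma> x" by metis
  obtain x0 where x0: "x0 \<in> I" using nonempty by blast
  have "a * d \<noteq> b * c"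
  proof
    \<comment> \<open>A vanishing determinant would give \<open>a * \<phi> = c\<close> and
      \<open>b * \<phi> = d\<close> on \<open>I\<close>. As \<open>\<phi>\<close> takes two
      different values, \<open>a = b = 0\<close>, and then \<open>f1\<close> would vanish.\<close>
    assume 0: "a * d = b * c"
    have e: "a * \<phi> x = c" "b * \<phi> x = d" if x: "x \<in> I" for x
    proof -
      have "(a * \<phi> x) * f1 x = a * F1 x" using o(8)[OF x] by simp
      also have "\<dots> = c * (a * sine \<gamma> x) + (a * d) * cosine \<gamma> x" using cd[OF x] by (simp add: algebra_simps)
      also have "\<dots> = c * f1 x" unfolding 0 ab[OF x] by (simp add: algebra_simps)
      finally show "a * \<phi> x = c" using o(7)[OF x] by simp
      have "(b * \<phi> x) * f1 x = b * F1 x" using o(8)[OF x] by simp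
      also have "\<dots> = (b * c) * sine \<gamma> x + d * (b * cosine \<gamma> x)" using cd[OF x] by (simp add: algebra_simps)
      also have "\<dots> = d * f1 x" unfolding 0[symmetric] ab[OF x] by (simp add: algebra_simps)
      finally show "b * \<phi> x = d" using o(7)[OF x] by simp
    qed
    obtain y z where yz: "y \<in> I" "z \<in> I" "\<phi> ((x0 + y) / 2) \<noteq> \<phi> ((x0 + z) / 2)"
      using nonconst[OF x0] by blast
    note m = midpoint_mem[OF x0 yz(1)] midpoint_mem[OF x0 yz(2)]
    have "a = 0" "b = 0"
      using yz(3) mult_cancel_left[of a "\<phi> ((x0 + y) / 2)" "\<phi> ((x0 + z) / 2)"]
        mult_cancel_left[of b "\<phi> ((x0 + y) / 2)" "\<phi> ((x0 + z) / 2)"]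
      unfolding e[OF m(1)] e[OF m(2)] by auto
    with o(7)[OF x0] ab[OF x0] show False by simp
  qed
  then show thesis
  proof (rule that)
    fix x assume x: "x \<in> I"
    show "a * sine \<gamma> x + b * cosine \<gamma> x \<noteq> 0" using o(7)[OF x] ab[OF x] by simp
    show "\<phi> x = (c * sine \<gamma> x + d * cosine \<gamma> x) / (a * sine \<gamma> x + b * cosine \<gamma> x)"
      using o(7,8)[OF x] ab[OF x] cd[OF x] by (simp add: nonzero_eq_divide_eq)
    show "(f has_real_derivative a * sine \<gamma> x + b * cosine \<gamma> x) (at x)"
      using o(1)[OF x] ab[OF x] by simp
    show "(F has_real_derivative c * sine \<gamma> x + d * cosine \<gamma> x) (at x)"
      using o(4)[OF x] cd[OF x] by simp
  qed
qed

lemma explicit_solution: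
  "\<exists>A B C D \<gamma> \<mu> lam :: real. A * D \<noteq> B * C \<and>
          (\<forall>x\<in>I.
            (\<gamma> < 0 \<longrightarrow>
               F x = - C * cos (sqrt (- \<gamma>) * x) + D * sin (sqrt (- \<gamma>) * x) + \<mu>
               \<and> f x = - A * cos (sqrt (- \<gamma>) * x) + B * sin (sqrt (- \<gamma>) * x) + lam
               \<and> A * sin (sqrt (- \<gamma>) * x) + B * cos (sqrt (- \<gamma>) * x) \<noteq> 0
               \<and> \<phi> x = (C * sin (sqrt (- \<gamma>) * x) + D * cos (sqrt (- \<gamma>) * x))
                       / (A * sin (sqrt (- \<gamma>) * x) + B * cos (sqrt (- \<gamma>) * x)))
            \<and> (\<gamma> = 0 \<longrightarrow>
               F x = 1 / 2 * C * x\<^sup>2 + D * x + \<mu>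
               \<and> f x = 1 / 2 * A * x\<^sup>2 + B * x + lam
               \<and> A * x + B \<noteq> 0
               \<and> \<phi> x = (C * x + D) / (A * x + B))
            \<and> (\<gamma> > 0 \<longrightarrow>
               F x = C * cosh (sqrt \<gamma> * x) + D * sinh (sqrt \<gamma> * x) + \<mu>
               \<and> f x = A * cosh (sqrt \<gamma> * x) + B * sinh (sqrt \<gamma> * x) + lam
               \<and> A * sinh (sqrt \<gamma> * x) + B * cosh (sqrt \<gamma> * x) \<noteq> 0
               \<and> \<phi> x = (C * sinh (sqrt \<gamma> * x) + D * cosh (sqrt \<gamma> * x))
                       / (A * sinh (sqrt \<gamma> * x) + B * cosh (sqrt \<gamma> * x))))"
proof -
  obtain \<gamma> a b c d where n: "a * d \<noteq> b * c"
    "\<And>x. x \<in> I \<Longrightarrow> a * sine \<gamma> x + b * cosine \<gamma> x \<noteq> 0"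
    "\<And>x. x \<in> I \<Longrightarrow> \<phi> x = (c * sine \<gamma> x + d * cosine \<gamma> x) / (a * sine \<gamma> x + b * cosine \<gamma> x)"
    "\<And>x. x \<in> I \<Longrightarrow> (f has_real_derivative a * sine \<gamma> x + b * cosine \<gamma> x) (at x)"
    "\<And>x. x \<in> I \<Longrightarrow> (F has_real_derivative c * sine \<gamma> x + d * cosine \<gamma> x) (at x)"
    using normal_form by metis
  have primitive: "\<exists>e. \<forall>x\<in>I. g x = G x + e"
    if "\<And>x. x \<in> I \<Longrightarrow> (g has_real_derivative g' x) (at x)"
      "\<And>x. x \<in> I \<Longrightarrow> (G has_real_derivative g' x) (at x)" for g g' G :: "real \<Rightarrow> real"
  proof -
    have "((\<lambda>x. g x - G x) has_real_derivative 0) (at x)" if "x \<in> I" for x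
      using DERIV_diff[OF \<open>\<And>x. x \<in> I \<Longrightarrow> (g has_real_derivative g' x) (at x)\<close>[OF that]
        \<open>\<And>x. x \<in> I \<Longrightarrow> (G has_real_derivative g' x) (at x)\<close>[OF that]] by simp
    from zero_derivative_imp_constant[OF interval this]
    obtain e where "\<And>x. x \<in> I \<Longrightarrow> g x - G x = e" by metis
    then show ?thesis by (intro exI[of _ e]) (simp add: diff_eq_eq)
  qed
  define w where "w = sqrt \<bar>\<gamma>\<bar>"
  consider "\<gamma> < 0" | "\<gamma> = 0" | "\<gamma> > 0" by linarith
  then show ?thesis
  proof cases
    case 1
    then have w: "w > 0" "sqrt (- \<gamma>) = w" by (auto simp: w_def)
    have sc: "sine \<gamma> x = sin (w * x) / w" "cosine \<gamma> x = cos (w * x)" for x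
      using 1 by (auto simp: sine_def cosine_def w)
    \<comment> \<open>\<open>sine\<close> already contains a factor \<open>1 / w\<close> and
      integration contributes another, hence the coefficients \<open>a / w^2\<close> and
      \<open>b / w\<close>.\<close>
    have G: "((\<lambda>x. - (a / w^2) * cos (w * x) + b / w * sin (w * x)) has_real_derivative a * sine \<gamma> x + b * cosine \<gamma> x) (at x)" for a b x
      using w(1) by (auto intro!: derivative_eq_intros simp: sc power2_eq_square)
    obtain lam where lam: "\<forall>x\<in>I. f x = - (a / w^2) * cos (w * x) + b / w * sin (w * x) + lam"
      using primitive[OF n(4) G] by metis
    obtain \<mu> where \<mu>: "\<forall>x\<in>I. F x = - (c / w^2) * cos (w * x) + d / w * sin (w * x) + \<mu>"
      using primitive[OF n(5) G] by metis
    \<comment> \<open>With the rescaled coefficients, numerator and denominator of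
      \<open>\<phi>\<close> both acquire the factor \<open>1 / w\<close>, which cancels.\<close>
    have e: "u * sin (w * x) / w^2 + v * cos (w * x) / w = (u * sine \<gamma> x + v * cosine \<gamma> x) / w" for u v x
      using w(1) by (simp add: sc field_simps power2_eq_square)
    have nd: "a / w^2 * (d / w) \<noteq> b / w * (c / w^2)"
      using n(1) w(1) by (simp add: field_simps)
    show ?thesis
      by (rule exI[of _ "a / w^2"], rule exI[of _ "b / w"], rule exI[of _ "c / w^2"], rule exI[of _ "d / w"],
          rule exI[of _ \<gamma>], rule exI[of _ \<mu>], rule exI[of _ lam])
        (use nd n(2,3) w 1 lam \<mu> in \<open>simp add: e\<close>)
  next
    case 2
    have sc: "sine \<gamma> x = x" "cosine \<gamma> x = 1" for x
      using 2 by (auto simp: sine_def cosine_def)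
    have G: "((\<lambda>x. 1 / 2 * a * x\<^sup>2 + b * x) has_real_derivative a * sine \<gamma> x + b * cosine \<gamma> x) (at x)" for a b x
      by (auto intro!: derivative_eq_intros simp: sc)
    obtain lam where lam: "\<forall>x\<in>I. f x = 1 / 2 * a * x\<^sup>2 + b * x + lam"
      using primitive[OF n(4) G] by metis
    obtain \<mu> where \<mu>: "\<forall>x\<in>I. F x = 1 / 2 * c * x\<^sup>2 + d * x + \<mu>"
      using primitive[OF n(5) G] by metis
    show ?thesis
      by (rule exI[of _ a], rule exI[of _ b], rule exI[of _ c], rule exI[of _ d],
          rule exI[of _ \<gamma>], rule exI[of _ \<mu>], rule exI[of _ lam])
        (use n(1-3)[unfolded sc] 2 lam \<mu> in simp)
  next
    case 3
    then have w: "w > 0" "sqrt \<gamma> = w" by (auto simp: w_def)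
    have sc: "sine \<gamma> x = sinh (w * x) / w" "cosine \<gamma> x = cosh (w * x)" for x
      using 3 by (auto simp: sine_def cosine_def w)
    have G: "((\<lambda>x. a / w^2 * cosh (w * x) + b / w * sinh (w * x)) has_real_derivative a * sine \<gamma> x + b * cosine \<gamma> x) (at x)" for a b x
      using w(1) by (auto intro!: derivative_eq_intros simp: sc power2_eq_square)
    obtain lam where lam: "\<forall>x\<in>I. f x = a / w^2 * cosh (w * x) + b / w * sinh (w * x) + lam"
      using primitive[OF n(4) G] by metis
    obtain \<mu> where \<mu>: "\<forall>x\<in>I. F x = c / w^2 * cosh (w * x) + d / w * sinh (w * x) + \<mu>"
      using primitive[OF n(5) G] by metis
    have e: "u * sinh (w * x) / w^2 + v * cosh (w * x) / w = (u * sine \<gamma> x + v * cosine \<gamma> x) / w" for u v x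
      using w(1) by (simp add: sc field_simps power2_eq_square)
    have nd: "a / w^2 * (d / w) \<noteq> b / w * (c / w^2)"
      using n(1) w(1) by (simp add: field_simps)
    show ?thesis
      by (rule exI[of _ "a / w^2"], rule exI[of _ "b / w"], rule exI[of _ "c / w^2"], rule exI[of _ "d / w"],
          rule exI[of _ \<gamma>], rule exI[of _ \<mu>], rule exI[of _ lam])
        (use nd n(2,3) w 3 lam \<mu> in \<open>simp add: e\<close>)
  qed
qed

end

section \<open>The characterization\<close>

lemma plateau_solution:
  fixes I K :: "real set" and \<phi> f F :: "real \<Rightarrow> real"
  assumes I: "is_interval I"
    and K: "K \<noteq> {}" "K \<subseteq> I" "is_interval K" "closedin (top_of_set I) K"
    and lo: "\<forall>x\<in>lower_part I K. f x = lam_lo" and up: "\<forall>x\<in>upper_part I K. f x = lam_up"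
    and half: "\<forall>x\<in>half_sum I K. \<phi> x = A" and F: "\<forall>x\<in>I. F x = A * f x + \<mu>"
    and x: "x \<in> I" and y: "y \<in> I"
  shows "\<phi> ((x + y) / 2) * (f x - f y) = F x - F y"
proof -
  have halfI: "\<phi> ((u + k) / 2) = A" if "u \<in> I" "k \<in> K" for u k
    using half that unfolding half_sum_def by blast
  \<comment> \<open>An infimum or supremum of \<open>K\<close> that is a point of \<open>I\<close>
    is approached by points of \<open>K\<close>; with relative closedness it belongs to
    \<open>K\<close>. So \<open>I\<close> consists of \<open>K\<close>, the part below and the part
    above.\<close>
  have limpt: "\<exists>k\<in>K. dist k u < e" if "u \<in> I" "u \<in> K \<or> ereal u = Inf (ereal ` K) \<or> ereal u = Sup (ereal ` K)" "e > 0" for u e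
  proof -
    consider "u \<in> K" | "ereal u = Inf (ereal ` K)" | "ereal u = Sup (ereal ` K)" using \<open>u \<in> K \<or> _\<close> by blast
    then show ?thesis
    proof cases
      case 1
      then show ?thesis using \<open>e > 0\<close> by (intro bexI[of _ u]) auto
    next
      case 2
      have "Inf (ereal ` K) < ereal (u + e)" using \<open>e > 0\<close> by (simp flip: 2)
      then obtain k where k: "k \<in> K" "ereal k < ereal (u + e)" by (auto simp: Inf_less_iff)
      moreover have "ereal u \<le> ereal k" unfolding 2 using k(1) by (rule INF_lower)
      ultimately show ?thesis by (intro bexI[of _ k]) (auto simp: dist_real_def)
    next
      case 3
      have "ereal (u - e) < Sup (ereal ` K)" using \<open>e > 0\<close> by (simp flip: 3)
      then obtain k where k: "k \<in> K" "ereal (u - e) < ereal k" by (auto simp: less_Sup_iff)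
      moreover have "ereal k \<le> ereal u" unfolding 3 using k(1) by (rule SUP_upper)
      ultimately show ?thesis by (intro bexI[of _ k]) (auto simp: dist_real_def)
    qed
  qed
  have split: "u \<in> K \<or> u \<in> lower_part I K \<or> u \<in> upper_part I K" if u: "u \<in> I" for u
  proof (cases "ereal u = Inf (ereal ` K) \<or> ereal u = Sup (ereal ` K)")
    case True
    have "u \<in> closure K" unfolding closure_approachable using limpt[OF u] True by blast
    moreover obtain S where S: "closed S" "K = I \<inter> S" using K(4) by (auto simp: closedin_closed)
    then have "closure K \<subseteq> S" by (intro closure_minimal) auto
    ultimately show ?thesis using u S(2) by blast
  next
    case False
    show ?thesis
    proof (cases "u \<in> lower_part I K \<or> u \<in> upper_part I K")
      case nb: False
      then have "Inf (ereal ` K) < ereal u" "ereal u < Sup (ereal ` K)"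
        using u False by (auto simp: lower_part_def upper_part_def)
      then obtain a b where "a \<in> K" "a < u" "b \<in> K" "u < b"
        by (auto simp: Inf_less_iff less_Sup_iff)
      then show ?thesis using K(3) by (meson less_imp_le mem_is_interval_1_I)
    qed simp
  qed
  have key: "f x = f y \<or> \<phi> ((x + y) / 2) = A" if x: "x \<in> I" and y: "y \<in> I" and "x \<le> y" for x y
  proof -
    obtain k where k: "k \<in> K" using K(1) by blast
    have below: "u < k" if "u \<in> lower_part I K" for u
    proof -
      have "ereal u < Inf (ereal ` K)" using that by (simp add: lower_part_def)
      also have "\<dots> \<le> ereal k" using k by (rule INF_lower)
      finally show ?thesis by simp
    qed
    have above: "k < u" if "u \<in> upper_part I K" for u
    proof -
      have "ereal k \<le> Sup (ereal ` K)" using k by (rule SUP_upper)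
      also have "\<dots> < ereal u" using that by (simp add: upper_part_def)
      finally show ?thesis by simp
    qed
    consider "x \<in> K" | "y \<in> K" | "x \<in> lower_part I K" "y \<in> lower_part I K"
      | "x \<in> upper_part I K" "y \<in> upper_part I K" | "x \<in> lower_part I K" "y \<in> upper_part I K"
      | "x \<in> upper_part I K" "y \<in> lower_part I K"
      using split[OF x] split[OF y] by blast
    then show ?thesis
    proof cases
      case 1
      then show ?thesis using halfI[OF y 1] by (simp add: add.commute)
    next
      case 2
      then show ?thesis using halfI[OF x 2] by simp
    next
      case 3
      then show ?thesis using lo by simp
    next
      case 4
      then show ?thesis using up by simp
    next
      case 5
      \<comment> \<open>With \<open>x < k < y\<close>, the point \<open>x + y - k\<close> lies
        between \<open>x\<close> and \<open>y\<close>, and its midpoint with \<open>k\<close> is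
        \<open>(x + y) / 2\<close>.\<close>
      have "x + y - k \<in> I"
        using I x y by (rule mem_is_interval_1_I) (use below[OF 5(1)] above[OF 5(2)] in auto)
      from halfI[OF this k] show ?thesis by simp
    next
      case 6
      then show ?thesis using below above \<open>x \<le> y\<close> by fastforce
    qed
  qed
  have "f x = f y \<or> \<phi> ((x + y) / 2) = A"
    using key[OF x y] key[OF y x] by (cases "x \<le> y") (auto simp: add.commute)
  then show ?thesis using F x y by (auto simp: algebra_simps)
qed

text \<open>In each family the differences of \<open>f\<close> and \<open>F\<close> share a factor
  \<open>2 * r\<close> depending only on half the difference of the arguments; the denominator of
  \<open>\<phi>\<close> at the midpoint cancels, also when \<open>r = 0\<close>.\<close>

lemma quotient_solution:
  fixes N M r :: real
  assumes "N \<noteq> 0" "p = M / N" "a = 2 * r * N" "b = 2 * r * M"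
  shows "p * a = b"
  using assms by simp

lemma midpoint_coordinates:
  fixes x y :: real
  obtains m d where "x = m + d" "y = m - d" "(x + y) / 2 = m"
  by (rule that[of "(x + y) / 2" "(x - y) / 2"]) (simp_all add: field_simps)

lemma explicit_is_solution:
  fixes I :: "real set" and \<phi> f F :: "real \<Rightarrow> real"
  assumes x: "x \<in> I" and y: "y \<in> I" and m: "(x + y) / 2 \<in> I"
    and s: "(\<exists>A B C D \<gamma> \<mu> lam :: real. A * D \<noteq> B * C \<and>
          (\<forall>x\<in>I.
            (\<gamma> < 0 \<longrightarrow>
               F x = - C * cos (sqrt (- \<gamma>) * x) + D * sin (sqrt (- \<gamma>) * x) + \<mu>
               \<and> f x = - A * cos (sqrt (- \<gamma>) * x) + B * sin (sqrt (- \<gamma>) * x) + lam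
               \<and> A * sin (sqrt (- \<gamma>) * x) + B * cos (sqrt (- \<gamma>) * x) \<noteq> 0
               \<and> \<phi> x = (C * sin (sqrt (- \<gamma>) * x) + D * cos (sqrt (- \<gamma>) * x))
                       / (A * sin (sqrt (- \<gamma>) * x) + B * cos (sqrt (- \<gamma>) * x)))
            \<and> (\<gamma> = 0 \<longrightarrow>
               F x = 1 / 2 * C * x\<^sup>2 + D * x + \<mu>
               \<and> f x = 1 / 2 * A * x\<^sup>2 + B * x + lam
               \<and> A * x + B \<noteq> 0
               \<and> \<phi> x = (C * x + D) / (A * x + B))
            \<and> (\<gamma> > 0 \<longrightarrow>
               F x = C * cosh (sqrt \<gamma> * x) + D * sinh (sqrt \<gamma> * x) + \<mu>
               \<and> f x = A * cosh (sqrt \<gamma> * x) + B * sinh (sqrt \<gamma> * x) + lam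
               \<and> A * sinh (sqrt \<gamma> * x) + B * cosh (sqrt \<gamma> * x) \<noteq> 0
               \<and> \<phi> x = (C * sinh (sqrt \<gamma> * x) + D * cosh (sqrt \<gamma> * x))
                       / (A * sinh (sqrt \<gamma> * x) + B * cosh (sqrt \<gamma> * x)))))"
  shows "\<phi> ((x + y) / 2) * (f x - f y) = F x - F y"
proof -
  obtain A B C D \<gamma> \<mu> lam :: real where sol:
    "\<forall>x\<in>I.
            (\<gamma> < 0 \<longrightarrow>
               F x = - C * cos (sqrt (- \<gamma>) * x) + D * sin (sqrt (- \<gamma>) * x) + \<mu>
               \<and> f x = - A * cos (sqrt (- \<gamma>) * x) + B * sin (sqrt (- \<gamma>) * x) + lam
               \<and> A * sin (sqrt (- \<gamma>) * x) + B * cos (sqrt (- \<gamma>) * x) \<noteq> 0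
               \<and> \<phi> x = (C * sin (sqrt (- \<gamma>) * x) + D * cos (sqrt (- \<gamma>) * x))
                       / (A * sin (sqrt (- \<gamma>) * x) + B * cos (sqrt (- \<gamma>) * x)))
            \<and> (\<gamma> = 0 \<longrightarrow>
               F x = 1 / 2 * C * x\<^sup>2 + D * x + \<mu>
               \<and> f x = 1 / 2 * A * x\<^sup>2 + B * x + lam
               \<and> A * x + B \<noteq> 0
               \<and> \<phi> x = (C * x + D) / (A * x + B))
            \<and> (\<gamma> > 0 \<longrightarrow>
               F x = C * cosh (sqrt \<gamma> * x) + D * sinh (sqrt \<gamma> * x) + \<mu>
               \<and> f x = A * cosh (sqrt \<gamma> * x) + B * sinh (sqrt \<gamma> * x) + lam
               \<and> A * sinh (sqrt \<gamma> * x) + B * cosh (sqrt \<gamma> * x) \<noteq> 0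
               \<and> \<phi> x = (C * sinh (sqrt \<gamma> * x) + D * cosh (sqrt \<gamma> * x))
                       / (A * sinh (sqrt \<gamma> * x) + B * cosh (sqrt \<gamma> * x)))"
    using s by blast
  obtain m d where md: "x = m + d" "y = m - d" "(x + y) / 2 = m" by (rule midpoint_coordinates)
  note sx = bspec[OF sol x] and sy = bspec[OF sol y] and sm = bspec[OF sol m, unfolded md(3)]
  consider "\<gamma> < 0" | "\<gamma> = 0" | "\<gamma> > 0" by linarith
  then show ?thesis
  proof cases
    case 1
    define w where "w = sqrt (- \<gamma>)"
    \<comment> \<open>Sum-to-product formula in the midpoint \<open>m\<close> and half-difference
      \<open>d\<close>, used once for \<open>f\<close> and once for \<open>F\<close>.\<close>
    have diff: "(- u * cos (w * x) + v * sin (w * x)) - (- u * cos (w * y) + v * sin (w * y))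
      = 2 * sin (w * d) * (u * sin (w * m) + v * cos (w * m))" for u v
      by (simp add: md(1,2) distrib_left right_diff_distrib cos_add cos_diff sin_add sin_diff)
    show ?thesis unfolding md(3)
    proof (rule quotient_solution)
      show "A * sin (w * m) + B * cos (w * m) \<noteq> 0"
        "\<phi> m = (C * sin (w * m) + D * cos (w * m)) / (A * sin (w * m) + B * cos (w * m))"
        using sm 1 unfolding w_def by blast+
      show "f x - f y = 2 * sin (w * d) * (A * sin (w * m) + B * cos (w * m))"
        using sx sy 1 diff[of A B] unfolding w_def by simp
      show "F x - F y = 2 * sin (w * d) * (C * sin (w * m) + D * cos (w * m))"
        using sx sy 1 diff[of C D] unfolding w_def by simp
    qed
  next
    case 2
    have diff: "(1 / 2 * u * x\<^sup>2 + v * x) - (1 / 2 * u * y\<^sup>2 + v * y) = 2 * d * (u * m + v)" for u v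
      by (simp add: md(1,2) power2_eq_square) (simp add: field_simps)
    show ?thesis unfolding md(3)
    proof (rule quotient_solution)
      show "A * m + B \<noteq> 0" "\<phi> m = (C * m + D) / (A * m + B)" using sm 2 by blast+
      show "f x - f y = 2 * d * (A * m + B)" using sx sy 2 diff[of A B] by simp
      show "F x - F y = 2 * d * (C * m + D)" using sx sy 2 diff[of C D] by simp
    qed
  next
    case 3
    define w where "w = sqrt \<gamma>"
    have diff: "(u * cosh (w * x) + v * sinh (w * x)) - (u * cosh (w * y) + v * sinh (w * y))
      = 2 * sinh (w * d) * (u * sinh (w * m) + v * cosh (w * m))" for u v
      by (simp add: md(1,2) distrib_left right_diff_distrib cosh_add cosh_diff sinh_add sinh_diff)
    show ?thesis unfolding md(3)
    proof (rule quotient_solution)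
      show "A * sinh (w * m) + B * cosh (w * m) \<noteq> 0"
        "\<phi> m = (C * sinh (w * m) + D * cosh (w * m)) / (A * sinh (w * m) + B * cosh (w * m))"
        using sm 3 unfolding w_def by blast+
      show "f x - f y = 2 * sinh (w * d) * (A * sinh (w * m) + B * cosh (w * m))"
        using sx sy 3 diff[of A B] unfolding w_def by simp
      show "F x - F y = 2 * sinh (w * d) * (C * sinh (w * m) + D * cosh (w * m))"
        using sx sy 3 diff[of C D] unfolding w_def by simp
    qed
  qed
qed

theorem theorem23:
  fixes I :: "real set" and \<phi> f F :: "real \<Rightarrow> real"
  assumes "is_interval I" and "open I" and "I \<noteq> {}"
    and "continuous_on I \<phi>"
  shows "(\<forall>x\<in>I. \<forall>y\<in>I. \<phi> ((x + y) / 2) * (f x - f y) = F x - F y) \<longleftrightarrow>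
    (f constant_on I \<and> F constant_on I)
    \<or> (\<exists>A\<in>\<phi> ` I. \<exists>K lam_lo lam_up \<mu>.
          K \<noteq> {} \<and> K \<subseteq> I \<and> is_interval K \<and> closedin (top_of_set I) K
          \<and> (\<forall>x\<in>lower_part I K. f x = lam_lo)
          \<and> (\<forall>x\<in>upper_part I K. f x = lam_up)
          \<and> (\<forall>x\<in>half_sum I K. \<phi> x = A)
          \<and> (\<forall>x\<in>I. F x = A * f x + \<mu>))
    \<or> (\<exists>A B C D \<gamma> \<mu> lam :: real. A * D \<noteq> B * C \<and>
          (\<forall>x\<in>I.
            (\<gamma> < 0 \<longrightarrow>
               F x = - C * cos (sqrt (- \<gamma>) * x) + D * sin (sqrt (- \<gamma>) * x) + \<mu>
               \<and> f x = - A * cos (sqrt (- \<gamma>) * x) + B * sin (sqrt (- \<gamma>) * x) + lam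
               \<and> A * sin (sqrt (- \<gamma>) * x) + B * cos (sqrt (- \<gamma>) * x) \<noteq> 0
               \<and> \<phi> x = (C * sin (sqrt (- \<gamma>) * x) + D * cos (sqrt (- \<gamma>) * x))
                       / (A * sin (sqrt (- \<gamma>) * x) + B * cos (sqrt (- \<gamma>) * x)))
            \<and> (\<gamma> = 0 \<longrightarrow>
               F x = 1 / 2 * C * x\<^sup>2 + D * x + \<mu>
               \<and> f x = 1 / 2 * A * x\<^sup>2 + B * x + lam
               \<and> A * x + B \<noteq> 0
               \<and> \<phi> x = (C * x + D) / (A * x + B))
            \<and> (\<gamma> > 0 \<longrightarrow>
               F x = C * cosh (sqrt \<gamma> * x) + D * sinh (sqrt \<gamma> * x) + \<mu>
               \<and> f x = A * cosh (sqrt \<gamma> * x) + B * sinh (sqrt \<gamma> * x) + lam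
               \<and> A * sinh (sqrt \<gamma> * x) + B * cosh (sqrt \<gamma> * x) \<noteq> 0
               \<and> \<phi> x = (C * sinh (sqrt \<gamma> * x) + D * cosh (sqrt \<gamma> * x))
                       / (A * sinh (sqrt \<gamma> * x) + B * cosh (sqrt \<gamma> * x)))))"
  (is "?E \<longleftrightarrow> ?i \<or> ?ii \<or> ?iii")
proof
  assume ?E
  then interpret midpoint_equation I \<phi> f F
    using assms by unfold_locales auto
  have ii: ?ii if "\<exists>A \<mu>. \<forall>x\<in>I. F x = A * f x + \<mu>" "\<not> f constant_on I"
  proof -
    obtain A \<mu> where "\<And>x. x \<in> I \<Longrightarrow> F x = A * f x + \<mu>" using \<open>\<exists>A \<mu>. _ A \<mu>\<close> by auto
    from affine_imp_plateau[OF this \<open>\<not> f constant_on I\<close>] show ?ii .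
  qed
  show "?i \<or> ?ii \<or> ?iii"
  proof (cases "f constant_on I")
    case True
    then obtain c where "\<And>x. x \<in> I \<Longrightarrow> f x = c" by (auto simp: constant_on_def)
    moreover obtain x0 where "x0 \<in> I" using assms(3) by blast
    ultimately have "F x = F x0" if "x \<in> I" for x using f_eq_imp_F_eq[OF that \<open>x0 \<in> I\<close>] that by simp
    then have "F constant_on I" by (auto simp: constant_on_def)
    with True show ?thesis by blast
  next
    case nc: False
    show ?thesis
    \<comment> \<open>If \<open>\<phi>\<close> is constant on the midpoints with some
      \<open>x0\<close>, its value there is the one at \<open>(x0 + x0) / 2\<close>. Otherwise every
      \<open>x\<close> satisfies \<open>nonconst\<close>, with \<open>z = x\<close> as one
      witness.\<close>
    proof (cases "\<exists>x0\<in>I. \<forall>y\<in>I. \<phi> ((x0 + y) / 2) = \<phi> ((x0 + x0) / 2)")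
      case True
      then obtain x0 where "x0 \<in> I" "\<And>y. y \<in> I \<Longrightarrow> \<phi> ((x0 + y) / 2) = \<phi> ((x0 + x0) / 2)" by blast
      from constant_midpoints_imp_affine[OF this] have ?ii by (intro ii nc) blast
      then show ?thesis by blast
    next
      case False
      then have nonconst: "\<exists>y\<in>I. \<exists>z\<in>I. \<phi> ((x + y) / 2) \<noteq> \<phi> ((x + z) / 2)" if "x \<in> I" for x
        using that by blast
      have cf: "continuous_on I f"
        by (intro continuous_at_imp_continuous_on ballI isCont_f nonconst)
      show ?thesis
      proof (cases "inj_on f I")
        case True
        interpret injective_midpoint I \<phi> f F
          by unfold_locales (fact assms(3) True cf nonconst)+
        show ?thesis using explicit_solution by blast
      next
        case False
        from noninjective_imp_affine[OF cf this] have ?ii by (rule ii[OF _ nc])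
        then show ?thesis by blast
      qed
    qed
  qed
next
  assume alt: "?i \<or> ?ii \<or> ?iii"
  show ?E
  proof (intro ballI)
    fix x y assume x: "x \<in> I" and y: "y \<in> I"
    from alt consider (i) ?i | (ii) ?ii | (iii) ?iii by blast
    then show "\<phi> ((x + y) / 2) * (f x - f y) = F x - F y"
    proof cases
      case i
      then have "f x = f y" "F x = F y" using x y by (auto simp: constant_on_def)
      then show ?thesis by simp
    next
      case ii
      then show ?thesis
      proof (elim bexE exE conjE)
        fix A K lam_lo lam_up \<mu>
        assume "K \<noteq> {}" "K \<subseteq> I" "is_interval K" "closedin (top_of_set I) K"
          "\<forall>x\<in>lower_part I K. f x = lam_lo" "\<forall>x\<in>upper_part I K. f x = lam_up"
          "\<forall>x\<in>half_sum I K. \<phi> x = A" "\<forall>x\<in>I. F x = A * f x + \<mu>"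
        from plateau_solution[OF assms(1) this x y] show ?thesis .
      qed
    next
      case iii
      have "min x y \<in> I" "max x y \<in> I" using x y by (auto simp: min_def max_def)
      with assms(1) have "(x + y) / 2 \<in> I"
        by (rule mem_is_interval_1_I) (auto simp: min_def max_def)
      from explicit_is_solution[OF x y this iii] show ?thesis .
    qed
  qed
qed

end
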